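(* Let $\Omega\subset S^{n-1}$ be a closed set not contained in any closed hemisphere of $S^{n-1}$. Let $g\in C(\Omega)$, let $h_0\in C^+(\Omega)$, and let $a\in\mathbb{R}\cup\{-\infty\}$. Suppose that $\varphi\in\mathcal{J}_a$ is continuously differentiable and such that $\varphi'$ is nonzero on $(0,\infty)$. If $G:(0,\infty)\times S^{n-1}\to(0,\infty)$ and $G_t=\partial G/\partial t$ are continuous on $(0,\infty)\times S^{n-1}$, then $$\lim_{\varepsilon\to0}\frac{\widetilde{V}_G([h_\varepsilon])-\widetilde{V}_G([h_0])}{\varepsilon}=n\int_\Omega g(u)\,d\widetilde{C}_{G,\psi}([h_0],u),$$ where $\psi(t)=t\varphi'(t)$ and, for $\varepsilon\in\mathbb{R}$ close to $0$, $h_\varepsilon\in C^+(\Omega)$ is given by $h_\varepsilon(u)=\varphi^{-1}(\varphi(h_0(u))+\varepsilon g(u))$, $u\in\Omega$.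
   Context: $C(\Omega)$ is the set of continuous real functions on $\Omega$ and $C^+(\Omega)$ the set of strictly positive ones. $\mathcal{J}_a$ is the class of functions $\varphi:(0,\infty)\to(a,\infty)$ that are continuous and strictly monotonic with $\inf_{t>0}\varphi(t)=a$ and $\sup_{t>0}\varphi(t)=\infty$. For $f\in C^+(\Omega)$, the Aleksandrov body of $f$ is $[f]=\bigcap_{u\in\Omega}\{x\in\mathbb{R}^n:\langle x,u\rangle\le f(u)\}$, which belongs to $\mathcal{K}_o^n$, the class of compact convex sets in $\mathbb{R}^n$ containing the origin in their interiors. Integration on $S^{n-1}$ is with respect to $du=d\mathcal{H}^{n-1}(u)$. For $K\in\mathcal{K}_o^n$: $h_K(u)=\sup_{x\in K}\langle u,x\rangle$ is the support function; $\rho_K(u)=\sup\{\lambda>0:\lambda u\in K\}$ is the radial function; the general dual volume is $\widetilde{V}_G(K)=\int_{S^{n-1}}G(\rho_K(u),u)\,du$; $H(K,u)=\{x:\langle x,u\rangle=h_K(u)\}$; for $\mathcal{H}^{n-1}$-almost all $u\in S^{n-1}$, $\alpha_K(u)$ is the unique outer unit normal vector of $K$ at $\rho_K(u)u$; and for $E\subset S^{n-1}$, $\boldsymbol{\alpha}_K^*(E)=\{x/|x|:x\in\partial K\cap H(K,u)\text{ for some }u\in E\}$. For a continuous nowhere vanishing $\psi:(0,\infty)\to\mathbb{R}$, the general dual Orlicz curvature measure is the finite signed Borel measure on $S^{n-1}$ given by $$\widetilde{C}_{G,\psi}(K,E)=\frac1n\int_{\boldsymbol{\alpha}_K^*(E)}\frac{\rho_K(u)\,G_t(\rho_K(u),u)}{\psi(h_K(\alpha_K(u)))}\,du$$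 for Borel sets $E\subset S^{n-1}$. *)

theory Defs
  imports "HOL-Analysis.Analysis"
begin

section \<open>Hausdorff measure\<close>

text \<open>
  The weight is normalised so that the \<open>d\<close>-dimensional Hausdorff measure agrees with Lebesgue
  measure in dimension \<open>d\<close>. The empty set is treated separately because \<open>0 ^ 0 = 1\<close>; for
  \<open>d = 0\<close> one obtains counting measure. Covering sets are required to be bounded because
  \<^const>\<open>diameter\<close> is unspecified on unbounded sets.
\<close>

definition hausdorff_weight :: "nat \<Rightarrow> 'a::metric_space set \<Rightarrow> ennreal" where
  "hausdorff_weight d U =
     (if U = {} then 0 else ennreal (unit_ball_vol (real d) * (diameter U / 2) ^ d))"

definition hausdorff_premeasure :: "nat \<Rightarrow> real \<Rightarrow> 'a::metric_space set \<Rightarrow> ennreal" where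
  "hausdorff_premeasure d \<delta> A =
     (INF U\<in>{U :: nat \<Rightarrow> 'a set. A \<subseteq> (\<Union>i. U i) \<and> (\<forall>i. bounded (U i) \<and> diameter (U i) \<le> \<delta>)}.
        \<Sum>i. hausdorff_weight d (U i))"

definition hausdorff_outer :: "nat \<Rightarrow> 'a::metric_space set \<Rightarrow> ennreal" where
  "hausdorff_outer d A = (SUP \<delta>\<in>{0<..}. hausdorff_premeasure d \<delta> A)"

text \<open>
  The measure lives on all Caratheodory measurable sets (not just the Borel sets): the reverse
  radial Gauss image of a Borel set is in general only measurable in this completed sense.
\<close>

definition hausdorff_measure :: "nat \<Rightarrow> 'a::metric_space measure" where
  "hausdorff_measure d =
     measure_of UNIV (lambda_system UNIV UNIV (hausdorff_outer d)) (hausdorff_outer d)"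

abbreviation sphere_measure :: "'a::euclidean_space measure" where
  "sphere_measure \<equiv> hausdorff_measure (DIM('a) - 1)"


section \<open>Integration with respect to a finite signed measure\<close>

text \<open>
  A finite signed measure on the measurable space \<open>M\<close> is given by its values \<open>\<mu>\<close> on
  \<open>sets M\<close>. Its positive variation is \<open>E \<mapsto> sup {\<mu> F | F \<subseteq> E measurable}\<close> (negative values are
  truncated to 0 by \<^const>\<open>ennreal\<close>, which is harmless since \<open>\<mu> {} = 0\<close>), and the negative
  variation is the positive variation of \<open>-\<mu>\<close>; together they form the Jordan decomposition.
\<close>

definition pos_variation :: "'a measure \<Rightarrow> ('a set \<Rightarrow> real) \<Rightarrow> 'a measure" where
  "pos_variation M \<mu> =
     measure_of (space M) (sets M) (\<lambda>E. SUP F\<in>{F \<in> sets M. F \<subseteq> E}. ennreal (\<mu> F))"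

definition signed_set_integral ::
    "'a measure \<Rightarrow> ('a set \<Rightarrow> real) \<Rightarrow> 'a set \<Rightarrow> ('a \<Rightarrow> real) \<Rightarrow> real" where
  "signed_set_integral M \<mu> A f =
     (LINT x:A|pos_variation M \<mu>. f x) - (LINT x:A|pos_variation M (\<lambda>E. - \<mu> E). f x)"


section \<open>Convex bodies\<close>

definition support_fun :: "'a::euclidean_space set \<Rightarrow> 'a \<Rightarrow> real" where
  "support_fun K u = (SUP x\<in>K. u \<bullet> x)"

definition radial_fun :: "'a::euclidean_space set \<Rightarrow> 'a \<Rightarrow> real" where
  "radial_fun K u = Sup {l :: real. l > 0 \<and> l *\<^sub>R u \<in> K}"

definition support_plane :: "'a::euclidean_space set \<Rightarrow> 'a \<Rightarrow> 'a set" where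
  "support_plane K u = {x. x \<bullet> u = support_fun K u}"

text \<open>
  A unit vector \<open>v\<close> is an outer normal of \<open>K\<close> at a boundary point \<open>x\<close> iff \<open>x\<close> lies on the
  supporting hyperplane with outer normal \<open>v\<close>. It is unique for almost all \<open>u\<close>; the value of
  \<open>radial_gauss\<close> elsewhere is irrelevant.
\<close>

definition radial_gauss :: "'a::euclidean_space set \<Rightarrow> 'a \<Rightarrow> 'a" where
  "radial_gauss K u = (THE v. v \<in> sphere 0 1 \<and> radial_fun K u *\<^sub>R u \<in> support_plane K v)"

definition reverse_radial_gauss_image :: "'a::euclidean_space set \<Rightarrow> 'a set \<Rightarrow> 'a set" where
  "reverse_radial_gauss_image K E =
     {x /\<^sub>R norm x | x u. u \<in> E \<and> x \<in> frontier K \<inter> support_plane K u}"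

definition aleksandrov_body :: "'a::euclidean_space set \<Rightarrow> ('a \<Rightarrow> real) \<Rightarrow> 'a set" where
  "aleksandrov_body \<Omega> f = (\<Inter>u\<in>\<Omega>. {x. x \<bullet> u \<le> f u})"

definition dual_volume :: "(real \<Rightarrow> 'a::euclidean_space \<Rightarrow> real) \<Rightarrow> 'a set \<Rightarrow> real" where
  "dual_volume G K = (LINT u:sphere 0 1|sphere_measure. G (radial_fun K u) u)"

definition partial_t :: "(real \<Rightarrow> 'a \<Rightarrow> real) \<Rightarrow> real \<Rightarrow> 'a \<Rightarrow> real" where
  "partial_t G t u = deriv (\<lambda>s. G s u) t"

definition dual_curvature ::
    "(real \<Rightarrow> 'a::euclidean_space \<Rightarrow> real) \<Rightarrow> (real \<Rightarrow> real) \<Rightarrow> 'a set \<Rightarrow> 'a set \<Rightarrow> real" where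
  "dual_curvature G \<psi> K E =
     1 / real DIM('a) *
     (LINT u:reverse_radial_gauss_image K E|sphere_measure.
        radial_fun K u * partial_t G (radial_fun K u) u / \<psi> (support_fun K (radial_gauss K u)))"


section \<open>The data of the variational formula\<close>

definition class_J :: "ereal \<Rightarrow> (real \<Rightarrow> real) set" where
  "class_J a = {\<phi>.
     (\<forall>t>0. a < ereal (\<phi> t)) \<and>
     continuous_on {0<..} \<phi> \<and>
     (strict_mono_on {0<..} \<phi> \<or> strict_antimono_on {0<..} \<phi>) \<and>
     (INF t\<in>{0<..}. ereal (\<phi> t)) = a \<and>
     (SUP t\<in>{0<..}. ereal (\<phi> t)) = \<infinity>}"

definition closed_hemisphere :: "'a::euclidean_space \<Rightarrow> 'a set" where
  "closed_hemisphere v = {u \<in> sphere 0 1. u \<bullet> v \<ge> 0}"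

definition orlicz_perturbation ::
    "(real \<Rightarrow> real) \<Rightarrow> ('a \<Rightarrow> real) \<Rightarrow> ('a \<Rightarrow> real) \<Rightarrow> real \<Rightarrow> 'a \<Rightarrow> real" where
  "orlicz_perturbation \<phi> h g \<epsilon> u = inv_into {0<..} \<phi> (\<phi> (h u) + \<epsilon> * g u)"

end

theory Submission
  imports Defs
begin

text \<open>
  The dual volume depends on the body only through its radial function, and for an Aleksandrov
  body that function is explicit: \<open>\<rho>\<close> at \<open>u\<close> is \<open>1 / P u\<close>, where the gauge
  \<open>P u = max\<^sub>v (u \<bullet> v) / h v\<close> is a maximum over the compact set \<open>\<Omega>\<close>. A maximiser \<open>v\<close> is an outer
  normal of the body at its boundary point in direction \<open>u\<close>, and there the support function
  agrees with \<open>h\<close>.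

  The perturbed function \<open>1 / h\<^sub>\<epsilon>\<close> is differentiable in \<open>\<epsilon>\<close> at \<open>0\<close>, uniformly on \<open>\<Omega>\<close>, because the
  inverse of \<open>\<phi>\<close> is continuously differentiable on an open set containing the compact range of
  \<open>\<phi> \<circ> h\<^sub>0\<close> (\<open>orlicz_perturbation_reciprocal\<close>). By Danskin's theorem (\<open>danskin\<close>) a maximum of
  such functions is differentiable wherever the maximiser is unique, and its derivative is the
  derivative at that maximiser. Hence \<open>\<epsilon> \<mapsto> \<rho>\<close> is differentiable at every \<open>u\<close> with only one
  outer normal \<open>\<alpha> u\<close>, with derivative \<open>\<rho> g (\<alpha> u) / \<psi> (h\<^sub>0 (\<alpha> u))\<close>. The difference quotients are
  bounded uniformly in \<open>u\<close>, so dominated convergence gives the derivative of the dual volume as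
  an integral over the sphere (\<open>dual_volume_derivative\<close>).

  Two measure-theoretic facts complete the argument. First, the directions with more than one
  normal are a null set (\<open>nonunique_normal_directions_null\<close>). If \<open>x\<close> has two normals then the
  points whose nearest point of the body is \<open>x\<close> contain a two-dimensional cone, so they meet
  one of countably many fixed planes of codimension two; the nearest-point map is 1-Lipschitz, and
  Lipschitz images of such planes are null for the \<open>(n - 1)\<close>-dimensional measure. Secondly, the
  dual curvature measure is the image under \<open>\<alpha>\<close> of a signed measure with integrable density, and
  integration against its Jordan decomposition obeys the change-of-variables formula
  (\<open>signed_set_integral_image\<close>). That turns the integral over the sphere into the integral of \<open>g\<close>
  over \<open>\<Omega>\<close>.
\<close>

section \<open>Hausdorff measure\<close>

lemma hausdorff_weight_empty [simp]: "hausdorff_weight d {} = 0"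
  by (simp add: hausdorff_weight_def)

lemma hausdorff_premeasure_antimono:
  assumes "\<delta>' \<le> \<delta>"
  shows "hausdorff_premeasure d \<delta> A \<le> hausdorff_premeasure d \<delta>' A"
  unfolding hausdorff_premeasure_def using assms
  by (intro INF_superset_mono) (auto intro: order_trans)

lemma hausdorff_premeasure_mono:
  assumes "A \<subseteq> B"
  shows "hausdorff_premeasure d \<delta> A \<le> hausdorff_premeasure d \<delta> B"
  unfolding hausdorff_premeasure_def using assms
  by (intro INF_superset_mono) auto

lemma hausdorff_premeasure_le:
  assumes "A \<subseteq> (\<Union>i. U i)" "\<And>i. bounded (U i)" "\<And>i. diameter (U i) \<le> \<delta>"
  shows "hausdorff_premeasure d \<delta> A \<le> (\<Sum>i. hausdorff_weight d (U i))"
  unfolding hausdorff_premeasure_def using assms by (intro INF_lower) auto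

lemma hausdorff_premeasure_le_outer:
  assumes "\<delta> > 0"
  shows "hausdorff_premeasure d \<delta> A \<le> hausdorff_outer d A"
  unfolding hausdorff_outer_def using assms by (intro SUP_upper) auto

lemma hausdorff_outer_mono:
  assumes "A \<subseteq> B"
  shows "hausdorff_outer d A \<le> hausdorff_outer d B"
  unfolding hausdorff_outer_def by (intro SUP_mono) (auto intro: hausdorff_premeasure_mono[OF assms])

lemma hausdorff_outer_empty [simp]: "hausdorff_outer d {} = 0"
proof -
  have "hausdorff_premeasure d \<delta> {} = 0" if "\<delta> > 0" for \<delta>
    using hausdorff_premeasure_le[of "{}" "\<lambda>_. {}" \<delta> d] that by simp
  then show ?thesis
    unfolding hausdorff_outer_def by (intro antisym SUP_least) auto
qed

lemma hausdorff_premeasure_subadditive: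
  fixes A :: "nat \<Rightarrow> 'a::metric_space set"
  shows "hausdorff_premeasure d \<delta> (\<Union>i. A i) \<le> (\<Sum>i. hausdorff_premeasure d \<delta> (A i))"
proof (cases "\<exists>i. hausdorff_premeasure d \<delta> (A i) = \<infinity>")
  case True
  then obtain i where i: "hausdorff_premeasure d \<delta> (A i) = \<infinity>" by blast
  have "hausdorff_premeasure d \<delta> (A i) \<le> (\<Sum>i. hausdorff_premeasure d \<delta> (A i))"
    using sum_le_suminf[of "\<lambda>i. hausdorff_premeasure d \<delta> (A i)" "{i}"] by simp
  then show ?thesis using i by (simp add: top_unique)
next
  case False
  show ?thesis
  proof (rule ennreal_le_epsilon)
    fix e :: real assume e: "e > 0"
    have "\<exists>U. A i \<subseteq> (\<Union>k. U k) \<and> (\<forall>k. bounded (U k) \<and> diameter (U k) \<le> \<delta>) \<and>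
        (\<Sum>k. hausdorff_weight d (U k)) \<le> hausdorff_premeasure d \<delta> (A i) + ennreal e * ennreal ((1/2)^Suc i)" for i
    proof -
      have "hausdorff_premeasure d \<delta> (A i) < hausdorff_premeasure d \<delta> (A i) + ennreal e * ennreal ((1/2)^Suc i)"
        using False e by (auto simp: less_top ennreal_zero_less_mult_iff simp del: power_Suc)
      then show ?thesis
        by (subst (asm) (1) hausdorff_premeasure_def) (auto simp: INF_less_iff intro: less_imp_le)
    qed
    then obtain U where U: "\<And>i. A i \<subseteq> (\<Union>k. U i k)" "\<And>i k. bounded (U i k)"
        "\<And>i k. diameter (U i k) \<le> \<delta>"
        "\<And>i. (\<Sum>k. hausdorff_weight d (U i k)) \<le> hausdorff_premeasure d \<delta> (A i) + ennreal e * ennreal ((1/2)^Suc i)"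
      by metis
    have half: "(\<Sum>i. ennreal ((1/2)^Suc i)) = ennreal 1"
      by (rule suminf_ennreal_eq[OF _ power_half_series]) simp
    have "hausdorff_premeasure d \<delta> (\<Union>i. A i)
        \<le> (\<Sum>n. hausdorff_weight d (case prod_decode n of (i, k) \<Rightarrow> U i k))"
    proof (rule hausdorff_premeasure_le)
      show "(\<Union>i. A i) \<subseteq> (\<Union>n. case prod_decode n of (i, k) \<Rightarrow> U i k)"
      proof
        fix x assume "x \<in> (\<Union>i. A i)"
        then obtain i k where "x \<in> U i k" using U(1) by blast
        then show "x \<in> (\<Union>n. case prod_decode n of (i, k) \<Rightarrow> U i k)"
          by (intro UN_I[of "prod_encode (i, k)"]) auto
      qed
    qed (auto split: prod.split simp: U)
    also have "\<dots> = (\<Sum>i. \<Sum>k. hausdorff_weight d (U i k))"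
      using suminf_ennreal_2dimen[of "\<lambda>i. \<Sum>k. hausdorff_weight d (U i k)"
          "\<lambda>(i,k). hausdorff_weight d (U i k)"]
      by (simp add: case_prod_unfold)
    also have "\<dots> \<le> (\<Sum>i. hausdorff_premeasure d \<delta> (A i) + ennreal e * ennreal ((1/2)^Suc i))"
      by (intro suminf_le U) auto
    also have "\<dots> = (\<Sum>i. hausdorff_premeasure d \<delta> (A i)) + (\<Sum>i. ennreal e * ennreal ((1/2)^Suc i))"
      by (subst suminf_add) auto
    also have "(\<Sum>i. ennreal e * ennreal ((1/2)^Suc i)) = ennreal e"
      by (simp only: ennreal_suminf_cmult half ennreal_1 mult_1_right)
    finally show "hausdorff_premeasure d \<delta> (\<Union>i. A i)
        \<le> (\<Sum>i. hausdorff_premeasure d \<delta> (A i)) + ennreal e" .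
  qed
qed

lemma hausdorff_outer_subadditive:
  fixes A :: "nat \<Rightarrow> 'a::metric_space set"
  shows "hausdorff_outer d (\<Union>i. A i) \<le> (\<Sum>i. hausdorff_outer d (A i))"
  unfolding hausdorff_outer_def[of d "\<Union>i. A i"]
proof (rule SUP_least)
  fix \<delta> :: real assume "\<delta> \<in> {0<..}"
  then show "hausdorff_premeasure d \<delta> (\<Union>i. A i) \<le> (\<Sum>i. hausdorff_outer d (A i))"
    using hausdorff_premeasure_subadditive[of d \<delta> A]
    by (elim order_trans) (auto intro!: suminf_le hausdorff_premeasure_le_outer)
qed

lemma hausdorff_outer_Un_le: "hausdorff_outer d (A \<union> B) \<le> hausdorff_outer d A + hausdorff_outer d B"
proof -
  have "hausdorff_outer d (\<Union>i. if i = 0 then A else if i = Suc 0 then B else {})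
      \<le> (\<Sum>i. hausdorff_outer d (if i = 0 then A else if i = Suc 0 then B else {}))"
    by (rule hausdorff_outer_subadditive)
  also have "(\<Union>i. if i = 0 then A else if i = Suc 0 then B else {}) = A \<union> B"
    by (auto split: if_splits)
  also have "(\<Sum>i. hausdorff_outer d (if i = 0 then A else if i = Suc 0 then B else {}))
      = (\<Sum>i\<in>{0, Suc 0}. hausdorff_outer d (if i = 0 then A else if i = Suc 0 then B else {}))"
    by (intro suminf_finite) auto
  finally show ?thesis by simp
qed

lemma outer_measure_space_hausdorff_outer: "outer_measure_space UNIV (hausdorff_outer d)"
  unfolding outer_measure_space_def positive_def increasing_def countably_subadditive_def
  by (auto intro: hausdorff_outer_mono hausdorff_outer_subadditive)

lemma measure_space_hausdorff:
  "measure_space UNIV (lambda_system UNIV UNIV (hausdorff_outer d)) (hausdorff_outer d)"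
  using sigma_algebra.caratheodory_lemma[OF sigma_algebra_Pow[of UNIV]]
    outer_measure_space_hausdorff_outer[of d] by simp

lemma space_hausdorff_measure [simp]: "space (hausdorff_measure d) = UNIV"
  unfolding hausdorff_measure_def by (simp add: space_measure_of_conv)

lemma sets_hausdorff_measure:
  "sets (hausdorff_measure d) = lambda_system UNIV UNIV (hausdorff_outer d)"
  unfolding hausdorff_measure_def
  by (intro sigma_algebra.sets_measure_of_eq
      measure_space_hausdorff[unfolded measure_space_def, THEN conjunct1])

lemma emeasure_hausdorff_measure:
  "A \<in> sets (hausdorff_measure d) \<Longrightarrow> emeasure (hausdorff_measure d) A = hausdorff_outer d A"
  unfolding sets_hausdorff_measure unfolding hausdorff_measure_def
  using measure_space_hausdorff[of d]
  by (intro emeasure_measure_of_sigma) (auto simp: measure_space_def)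

lemma in_sets_hausdorff_measureI:
  assumes "\<And>X. hausdorff_outer d (X \<inter> A) + hausdorff_outer d (X - A) \<le> hausdorff_outer d X"
  shows "A \<in> sets (hausdorff_measure d)"
proof -
  have "hausdorff_outer d X \<le> hausdorff_outer d (X \<inter> A) + hausdorff_outer d (X - A)" for X
    using hausdorff_outer_Un_le[of d "X \<inter> A" "X - A"] by (simp add: Int_Diff_Un)
  then show ?thesis
    unfolding sets_hausdorff_measure algebra.lambda_system_eq[OF algebra_Pow[of UNIV], simplified]
    using assms by (auto intro: antisym)
qed

lemma null_sets_hausdorff_measureI:
  assumes "hausdorff_outer d A = 0"
  shows "A \<in> null_sets (hausdorff_measure d)"
proof -
  have "A \<in> sets (hausdorff_measure d)"
  proof (rule in_sets_hausdorff_measureI)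
    fix X
    have "hausdorff_outer d (X \<inter> A) = 0"
      using hausdorff_outer_mono[of "X \<inter> A" A d] assms by simp
    then show "hausdorff_outer d (X \<inter> A) + hausdorff_outer d (X - A) \<le> hausdorff_outer d X"
      by (simp add: hausdorff_outer_mono)
  qed
  then show ?thesis
    using assms by (simp add: null_sets_def emeasure_hausdorff_measure)
qed

text \<open>
  A covering set whose diameter is smaller than the distance of \<open>A\<close> and \<open>B\<close> meets at most one of
  them, so every fine cover of the union splits into a cover of \<open>A\<close> and one of \<open>B\<close>.
\<close>
lemma hausdorff_outer_separated:
  fixes A B :: "'a::metric_space set"
  assumes r: "r > 0" and sep: "\<And>a b. a \<in> A \<Longrightarrow> b \<in> B \<Longrightarrow> r \<le> dist a b"
  shows "hausdorff_outer d A + hausdorff_outer d B \<le> hausdorff_outer d (A \<union> B)"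
proof -
  have pre: "hausdorff_premeasure d \<delta> A + hausdorff_premeasure d \<delta> B \<le> hausdorff_premeasure d \<delta> (A \<union> B)"
    if \<delta>: "\<delta> < r" for \<delta>
    unfolding hausdorff_premeasure_def[of d \<delta> "A \<union> B"]
  proof (rule INF_greatest)
    fix U assume "U \<in> {U::nat \<Rightarrow> 'a set. A \<union> B \<subseteq> (\<Union>i. U i) \<and> (\<forall>i. bounded (U i) \<and> diameter (U i) \<le> \<delta>)}"
    then have U: "A \<union> B \<subseteq> (\<Union>i. U i)" "\<And>i. bounded (U i)" "\<And>i. diameter (U i) \<le> \<delta>"
      by auto
    define V where "V C i = (if U i \<inter> C = {} then {} else U i)" for C i
    have V: "bounded (V C i)" "V C i \<noteq> {} \<Longrightarrow> diameter (V C i) \<le> \<delta>" for C i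
      using U by (auto simp: V_def)
    have V_cases: "V C i = {} \<or> V C i = U i" for C i by (simp add: V_def)
    have disj: "V A i = {} \<or> V B i = {}" for i
    proof (rule ccontr)
      assume "\<not> ?thesis"
      then obtain a b where ab: "a \<in> U i" "a \<in> A" "b \<in> U i" "b \<in> B"
        by (auto simp: V_def split: if_splits)
      have "r \<le> \<delta>"
        using sep[OF ab(2,4)] diameter_bounded_bound[OF U(2) ab(1,3)] U(3)[of i] by linarith
      with \<delta> show False by simp
    qed
    have \<delta>0: "0 \<le> \<delta>" using U(2,3) diameter_ge_0 order_trans by blast
    have le: "hausdorff_premeasure d \<delta> C \<le> (\<Sum>i. hausdorff_weight d (V C i))"
      if C: "C \<subseteq> A \<union> B" for C
    proof (rule hausdorff_premeasure_le)
      show "C \<subseteq> (\<Union>i. V C i)"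
      proof
        fix x assume x: "x \<in> C"
        then obtain i where "x \<in> U i" using C U(1) by blast
        with x have "x \<in> V C i" by (auto simp: V_def)
        then show "x \<in> (\<Union>i. V C i)" by blast
      qed
      show "diameter (V C i) \<le> \<delta>" for i
        using V(2)[of C i] \<delta>0 by (cases "V C i = {}") auto
    qed (use V in auto)
    have "hausdorff_premeasure d \<delta> A + hausdorff_premeasure d \<delta> B
        \<le> (\<Sum>i. hausdorff_weight d (V A i)) + (\<Sum>i. hausdorff_weight d (V B i))"
      by (intro add_mono le) auto
    also have "\<dots> = (\<Sum>i. hausdorff_weight d (V A i) + hausdorff_weight d (V B i))"
      by (intro suminf_add) auto
    also have "\<dots> \<le> (\<Sum>i. hausdorff_weight d (U i))"
    proof (intro suminf_le)
      show "hausdorff_weight d (V A i) + hausdorff_weight d (V B i) \<le> hausdorff_weight d (U i)" for i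
        using disj[of i] V_cases[of A i] V_cases[of B i] by auto
    qed auto
    finally show "hausdorff_premeasure d \<delta> A + hausdorff_premeasure d \<delta> B \<le> (\<Sum>i. hausdorff_weight d (U i))" .
  qed
  have "hausdorff_outer d A + hausdorff_outer d B
      = (SUP \<delta>\<in>{0<..}. hausdorff_premeasure d \<delta> A + hausdorff_premeasure d \<delta> B)"
    unfolding hausdorff_outer_def
  proof (rule SUP_add_directed_ennreal[symmetric])
    fix i j :: real assume "i \<in> {0<..}" "j \<in> {0<..}"
    then show "\<exists>k\<in>{0<..}. hausdorff_premeasure d i A + hausdorff_premeasure d j B
        \<le> hausdorff_premeasure d k A + hausdorff_premeasure d k B"
      by (intro bexI[of _ "min i j"] add_mono hausdorff_premeasure_antimono) auto
  qed
  also have "\<dots> \<le> hausdorff_outer d (A \<union> B)"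
  proof (rule SUP_least)
    fix \<delta> :: real assume "\<delta> \<in> {0<..}"
    then have m: "0 < min \<delta> (r/2)" using r by simp
    have "hausdorff_premeasure d \<delta> A + hausdorff_premeasure d \<delta> B
      \<le> hausdorff_premeasure d (min \<delta> (r/2)) A + hausdorff_premeasure d (min \<delta> (r/2)) B"
      by (intro add_mono hausdorff_premeasure_antimono) auto
    also have "\<dots> \<le> hausdorff_premeasure d (min \<delta> (r/2)) (A \<union> B)"
      using r by (intro pre) auto
    also have "\<dots> \<le> hausdorff_outer d (A \<union> B)"
      using m by (rule hausdorff_premeasure_le_outer)
    finally show "hausdorff_premeasure d \<delta> A + hausdorff_premeasure d \<delta> B \<le> hausdorff_outer d (A \<union> B)" .
  qed
  finally show ?thesis .
qed

lemma ennreal_suminf_tail_le: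
  fixes f :: "nat \<Rightarrow> ennreal"
  assumes "(\<Sum>j. f j) < \<infinity>" and e: "e > 0"
  shows "\<exists>k. (\<Sum>j. f (j + k)) \<le> ennreal e"
proof -
  have fin: "f j \<noteq> top" for j
    using assms(1) sum_le_suminf[of f "{j}"] by (auto simp: top_unique)
  define r where "r j = enn2real (f j)" for j
  have f: "f j = ennreal (r j)" and r0: "0 \<le> r j" for j
    using fin[of j] by (auto simp: r_def less_top)
  have r: "summable r"
    using assms(1) by (intro summable_suminf_not_top r0) (auto simp: f)
  obtain N where "norm (\<Sum>i. r (i + N)) < e"
    using suminf_exist_split[OF e r] by blast
  moreover have "(\<Sum>j. f (j + N)) = ennreal (\<Sum>i. r (i + N))"
    unfolding f using r r0 by (intro suminf_ennreal2) auto
  ultimately show ?thesis by (intro exI[of _ N]) (auto intro!: ennreal_leI)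
qed

text \<open>
  Caratheodory's criterion. The part \<open>D k\<close> of \<open>X\<close> at distance at least \<open>1 / (k + 1)\<close> from \<open>F\<close> is
  separated from \<open>X \<inter> F\<close>, so additivity holds for these two; it remains to let \<open>k\<close> grow. The
  shells \<open>R k\<close> between consecutive \<open>D k\<close> are separated from each other as soon as their indices
  differ by two. Their outer measures are therefore summable, and the tail of that series bounds
  what \<open>D k\<close> misses of \<open>X - F\<close>.
\<close>
lemma closed_in_sets_hausdorff_measure:
  fixes F :: "'a::metric_space set"
  assumes F: "closed F"
  shows "F \<in> sets (hausdorff_measure d)"
proof (cases "F = {}")
  case False
  show ?thesis
  proof (rule in_sets_hausdorff_measureI)
    fix X :: "'a set"
    let ?H = "hausdorff_outer d"
    define D where "D k = {x \<in> X. 1 / real (Suc k) \<le> infdist x F}" for k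
    define R where "R k = {x \<in> X. 1 / real (Suc (Suc k)) \<le> infdist x F \<and> infdist x F < 1 / real (Suc k)}" for k
    show "?H (X \<inter> F) + ?H (X - F) \<le> ?H X"
    proof (cases "?H X = \<infinity>")
      case fin: False
      have D_le: "?H (X \<inter> F) + ?H (D k) \<le> ?H X" for k
      proof -
        have "?H (X \<inter> F) + ?H (D k) \<le> ?H ((X \<inter> F) \<union> D k)"
        proof (rule hausdorff_outer_separated)
          show "0 < 1 / real (Suc k)" by simp
          fix a b assume "a \<in> X \<inter> F" "b \<in> D k"
          then show "1 / real (Suc k) \<le> dist a b"
            using infdist_le[of a F b] by (auto simp: D_def dist_commute)
        qed
        also have "\<dots> \<le> ?H X" by (intro hausdorff_outer_mono) (auto simp: D_def)
        finally show ?thesis .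
      qed
      have R_sep: "1 / real (Suc (Suc k)) - 1 / real (Suc l) \<le> dist a b"
        if "a \<in> R k" "b \<in> R l" for a b k l
        using that infdist_triangle[of a F b] by (auto simp: R_def)
      have R_sum: "(\<Sum>j<J. ?H (R (2 * j + p))) \<le> ?H (\<Union>j<J. R (2 * j + p))" for J p
      proof (induction J)
        case (Suc J)
        have "(\<Sum>j<Suc J. ?H (R (2 * j + p))) \<le> ?H (\<Union>j<J. R (2 * j + p)) + ?H (R (2 * J + p))"
          using Suc by (simp add: add_right_mono)
        also have "\<dots> \<le> ?H ((\<Union>j<J. R (2 * j + p)) \<union> R (2 * J + p))"
        proof (cases "J = 0")
          case J: False
          show ?thesis
          proof (rule hausdorff_outer_separated)
            show "0 < 1 / real (2 * J + p) - 1 / real (Suc (2 * J + p))"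
              using J by (simp add: divide_strict_left_mono)
            fix a b assume "a \<in> (\<Union>j<J. R (2 * j + p))" "b \<in> R (2 * J + p)"
            then obtain j where j: "j < J" "a \<in> R (2 * j + p)" by auto
            have "1 / real (2 * J + p) \<le> 1 / real (Suc (Suc (2 * j + p)))"
              using j by (intro divide_left_mono) auto
            with R_sep[OF j(2) \<open>b \<in> R (2 * J + p)\<close>]
            show "1 / real (2 * J + p) - 1 / real (Suc (2 * J + p)) \<le> dist a b" by linarith
          qed
        qed auto
        also have "(\<Union>j<J. R (2 * j + p)) \<union> R (2 * J + p) = (\<Union>j<Suc J. R (2 * j + p))"
          by (simp add: lessThan_Suc Un_commute)
        finally show ?case .
      qed auto
      have "(\<Sum>j<2 * J. ?H (R j)) = (\<Sum>j<J. ?H (R (2 * j + 0))) + (\<Sum>j<J. ?H (R (2 * j + 1)))" for J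
        by (induction J) (simp_all add: ac_simps)
      also have "\<dots> J \<le> ?H X + ?H X" for J
        by (intro add_mono order_trans[OF R_sum hausdorff_outer_mono]) (auto simp: R_def)
      finally have R_2: "(\<Sum>j<2 * J. ?H (R j)) \<le> ?H X + ?H X" for J .
      have "(\<Sum>j. ?H (R j)) \<le> ?H X + ?H X"
      proof (rule suminf_le_const)
        show "(\<Sum>j<J. ?H (R j)) \<le> ?H X + ?H X" for J
          by (rule order_trans[OF sum_mono2 R_2[of J]]) auto
      qed auto
      then have R_fin: "(\<Sum>j. ?H (R j)) < \<infinity>"
        using fin by (simp add: less_top order_le_less_trans)
      have cover: "X - F \<subseteq> D k \<union> (\<Union>j. R (j + k))" for k
      proof
        fix x assume x: "x \<in> X - F"
        then have pos: "infdist x F > 0"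
          using F False in_closed_iff_infdist_zero[of F x] infdist_nonneg[of x F] by fastforce
        show "x \<in> D k \<union> (\<Union>j. R (j + k))"
        proof (cases "x \<in> D k")
          case nD: False
          define P where "P n \<longleftrightarrow> 1 / real (Suc n) \<le> infdist x F" for n
          have nPk: "\<not> P k" using nD x by (auto simp: D_def P_def)
          have "\<exists>n. P n" using reals_Archimedean[OF pos] by (auto simp: P_def inverse_eq_divide intro: less_imp_le)
          define m where "m = (LEAST n. P n)"
          have Pm: "P m" unfolding m_def using \<open>\<exists>n. P n\<close> by (rule LeastI_ex)
          have "k < m"
          proof (rule ccontr)
            assume "\<not> k < m"
            then have "1 / real (Suc k) \<le> 1 / real (Suc m)" by (intro divide_left_mono) auto
            with Pm have "P k" unfolding P_def by linarith
            with nPk show False by simp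
          qed
          then obtain j where j: "m = Suc (j + k)" using less_imp_Suc_add by (metis add.commute)
          have "\<not> P (j + k)" using not_less_Least[of "j + k" P] j by (simp add: m_def)
          then have "x \<in> R (j + k)" using Pm x j by (auto simp: R_def P_def)
          then show ?thesis by blast
        qed simp
      qed
      show ?thesis
      proof (rule ennreal_le_epsilon)
        fix e :: real assume e: "e > 0"
        obtain k where k: "(\<Sum>j. ?H (R (j + k))) \<le> ennreal e"
          using ennreal_suminf_tail_le[OF R_fin e] by blast
        have "?H (X - F) \<le> ?H (D k) + ?H (\<Union>j. R (j + k))"
          by (rule order_trans[OF hausdorff_outer_mono[OF cover] hausdorff_outer_Un_le])
        also have "\<dots> \<le> ?H (D k) + ennreal e"
          by (intro add_left_mono order_trans[OF hausdorff_outer_subadditive k])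
        finally have "?H (X \<inter> F) + ?H (X - F) \<le> (?H (X \<inter> F) + ?H (D k)) + ennreal e"
          by (simp add: add_left_mono add.assoc)
        also have "\<dots> \<le> ?H X + ennreal e"
          by (intro add_right_mono D_le)
        finally show "?H (X \<inter> F) + ?H (X - F) \<le> ?H X + ennreal e" .
      qed
    qed simp
  qed
qed (use sets.empty_sets in simp)

lemma borel_subset_sets_hausdorff_measure:
  "sets (borel :: 'a::metric_space measure) \<subseteq> sets (hausdorff_measure d)"
proof -
  have "sigma_sets (space (hausdorff_measure d)) (Collect closed) \<subseteq> sets (hausdorff_measure d :: 'a measure)"
    by (rule sets.sigma_sets_subset) (auto intro: closed_in_sets_hausdorff_measure)
  then show ?thesis
    unfolding borel_eq_closed by (simp add: sets_measure_of)
qed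

text \<open>
  The Caratheodory construction yields a complete measure. Completeness is what makes the
  reverse radial Gauss image measurable: up to a null set it is a preimage under a continuous map.
\<close>
lemma null_sets_hausdorff_measure_subset:
  assumes "A \<in> null_sets (hausdorff_measure d)" "B \<subseteq> A"
  shows "B \<in> null_sets (hausdorff_measure d)"
proof (rule null_sets_hausdorff_measureI)
  have "hausdorff_outer d A = 0"
    using assms(1) emeasure_hausdorff_measure[of A d] by (simp add: null_sets_def)
  then show "hausdorff_outer d B = 0"
    using hausdorff_outer_mono[OF assms(2), of d] by simp
qed

text \<open>
  Applied to the set of regular directions, whose measurability is obtained by removing a null set
  from the sphere.
\<close>
lemma borel_measurable_hausdorff_continuous_indicator:
  fixes f :: "'a::metric_space \<Rightarrow> 'b::real_normed_vector"
  assumes A: "A \<in> sets (hausdorff_measure d)" and f: "continuous_on A f"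
  shows "(\<lambda>x. indicator A x *\<^sub>R f x) \<in> borel_measurable (hausdorff_measure d)"
proof -
  have "f \<in> borel_measurable (restrict_space borel A)"
    using f by (rule borel_measurable_continuous_on_restrict)
  then have "f \<in> borel_measurable (restrict_space (hausdorff_measure d) A)"
    using measurable_mono[of borel borel "restrict_space borel A" "restrict_space (hausdorff_measure d) A"]
      borel_subset_sets_hausdorff_measure[of d]
    by (auto simp: sets_restrict_space space_restrict_space)
  then show ?thesis using A by (subst (asm) borel_measurable_restrict_space_iff) auto
qed

lemma borel_measurable_hausdorff_modify_null:
  fixes f f' :: "'a::metric_space \<Rightarrow> real"
  assumes f: "f \<in> borel_measurable (hausdorff_measure d)" and N: "N \<in> null_sets (hausdorff_measure d)"
    and eq: "\<And>x. x \<notin> N \<Longrightarrow> f' x = f x"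
  shows "f' \<in> borel_measurable (hausdorff_measure d)"
proof (rule measurableI)
  fix B :: "real set" assume B: "B \<in> sets borel"
  have "f' -` B \<inter> N \<in> sets (hausdorff_measure d)"
    using null_sets_hausdorff_measure_subset[OF N, of "f' -` B \<inter> N"] by auto
  moreover have "f -` B - N \<in> sets (hausdorff_measure d)"
    using measurable_sets[OF f B] N by auto
  ultimately have "(f -` B - N) \<union> (f' -` B \<inter> N) \<in> sets (hausdorff_measure d)" by (intro sets.Un)
  also have "(f -` B - N) \<union> (f' -` B \<inter> N) = f' -` B" using eq by auto
  finally show "f' -` B \<inter> space (hausdorff_measure d) \<in> sets (hausdorff_measure d)" by simp
qed simp

section \<open>Lipschitz images of coordinate planes\<close>

text \<open>
  Coverings are sequences by definition; a finite family is padded with empty sets, which have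
  weight zero also in dimension \<open>0\<close>.
\<close>
lemma hausdorff_premeasure_le_finite:
  assumes fin: "finite I" and "\<delta> \<ge> 0" "A \<subseteq> (\<Union>k\<in>I. U k)"
    and "\<And>k. k \<in> I \<Longrightarrow> bounded (U k)" "\<And>k. k \<in> I \<Longrightarrow> diameter (U k) \<le> \<delta>"
  shows "hausdorff_premeasure d \<delta> A \<le> (\<Sum>k\<in>I. hausdorff_weight d (U k))"
proof -
  obtain e where e: "bij_betw e {..<card I} I"
    using ex_bij_betw_nat_finite[OF fin] by (auto simp: atLeast0LessThan)
  define V where "V n = (if n < card I then U (e n) else {})" for n
  have eI: "e n \<in> I" if "n < card I" for n using e that by (auto simp: bij_betw_def)
  have "hausdorff_premeasure d \<delta> A \<le> (\<Sum>n. hausdorff_weight d (V n))"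
  proof (rule hausdorff_premeasure_le)
    show "A \<subseteq> (\<Union>n. V n)"
    proof
      fix x assume "x \<in> A"
      then obtain k where k: "k \<in> I" "x \<in> U k" using assms(3) by blast
      then obtain n where "n < card I" "k = e n" using e by (auto simp: bij_betw_def)
      with k show "x \<in> (\<Union>n. V n)" by (intro UN_I[of n]) (auto simp: V_def)
    qed
  qed (use assms eI in \<open>auto simp: V_def\<close>)
  also have "\<dots> = (\<Sum>n\<in>{..<card I}. hausdorff_weight d (V n))"
    by (intro suminf_finite) (auto simp: V_def)
  also have "\<dots> = (\<Sum>n\<in>{..<card I}. hausdorff_weight d (U (e n)))"
    by (intro sum.cong) (auto simp: V_def)
  also have "\<dots> = (\<Sum>k\<in>I. hausdorff_weight d (U k))"
    by (rule sum.reindex_bij_betw[OF e])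
  finally show ?thesis .
qed

lemma unit_interval_subdivision:
  assumes "0 \<le> t" "t \<le> 1" "0 < N"
  shows "\<exists>k<N. real k / real N \<le> t \<and> t \<le> real (Suc k) / real N"
proof (cases "t = 1")
  case True
  then show ?thesis using assms by (intro exI[of _ "N - 1"]) (auto simp: field_simps)
next
  case False
  define k where "k = nat \<lfloor>t * real N\<rfloor>"
  have "t * real N \<ge> 0" using assms by simp
  then have k: "real k \<le> t * real N" "t * real N < real k + 1"
    unfolding k_def by linarith+
  have "t * real N < real N" using assms False by simp
  with k have "k < N" by linarith
  with k assms show ?thesis by (intro exI[of _ k]) (auto simp: field_simps)
qed

text \<open>
  A bounded piece of a \<open>d\<close>-dimensional coordinate plane splits into \<open>N ^ d\<close> cubes whose images
  have diameter at most \<open>C / N\<close>. Their total weight in dimension \<open>m\<close> is of order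
  \<open>N ^ d * (1 / N) ^ m\<close>: bounded for \<open>m = d\<close>, and tending to zero for \<open>m = d + 1\<close>.
\<close>
lemma
  fixes f :: "'a::euclidean_space \<Rightarrow> 'b::real_normed_vector"
  assumes B: "B \<subseteq> Basis"
    and box: "\<And>x i. x \<in> A \<Longrightarrow> i \<in> B \<Longrightarrow> \<bar>x \<bullet> i\<bar> \<le> M"
    and flat: "\<And>x y i. x \<in> A \<Longrightarrow> y \<in> A \<Longrightarrow> i \<in> Basis - B \<Longrightarrow> x \<bullet> i = y \<bullet> i"
    and lip: "\<And>x y. x \<in> A \<Longrightarrow> y \<in> A \<Longrightarrow> dist (f x) (f y) \<le> L * dist x y"
    and M: "M > 0" and L: "L \<ge> 0"
  shows hausdorff_outer_lipschitz_image_finite: "hausdorff_outer (card B) (f ` A) < \<infinity>"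
    and hausdorff_outer_lipschitz_image_null: "hausdorff_outer (Suc (card B)) (f ` A) = 0"
proof -
  let ?d = "card B"
  define C where "C = L * (real ?d * (2 * M))"
  have finB: "finite B" by (rule finite_subset[OF B finite_Basis])
  have C0: "C \<ge> 0" using M L by (simp add: C_def)
  have main: "hausdorff_premeasure m \<delta> (f ` A)
      \<le> ennreal (real (N ^ ?d) * (unit_ball_vol (real m) * (C / real N / 2) ^ m))"
    if N: "0 < N" and \<delta>: "C / real N \<le> \<delta>" for N m \<delta>
  proof -
    define I where "I = (\<Pi>\<^sub>E i\<in>B. {..<N})"
    define U where "U \<kappa> = f ` {x \<in> A. \<forall>i\<in>B. real (\<kappa> i) / real N \<le> (x \<bullet> i + M) / (2 * M) \<and>
        (x \<bullet> i + M) / (2 * M) \<le> real (Suc (\<kappa> i)) / real N}" for \<kappa> :: "'a \<Rightarrow> nat"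
    have finI: "finite I" using finB by (auto simp: I_def intro: finite_PiE)
    have cardI: "card I = N ^ ?d" using finB by (simp add: I_def card_PiE)
    have "0 \<le> C / real N" using C0 by simp
    with \<delta> have \<delta>0: "0 \<le> \<delta>" by (rule order_trans[rotated])
    have dist_U: "dist p q \<le> C / real N" if pq: "p \<in> U \<kappa>" "q \<in> U \<kappa>" for p q \<kappa>
    proof -
      obtain x y where x: "x \<in> A" "p = f x" and y: "y \<in> A" "q = f y"
        and xb: "\<forall>i\<in>B. real (\<kappa> i) / real N \<le> (x \<bullet> i + M) / (2 * M) \<and>
          (x \<bullet> i + M) / (2 * M) \<le> real (Suc (\<kappa> i)) / real N"
        and yb: "\<forall>i\<in>B. real (\<kappa> i) / real N \<le> (y \<bullet> i + M) / (2 * M) \<and>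
          (y \<bullet> i + M) / (2 * M) \<le> real (Suc (\<kappa> i)) / real N"
        using pq by (auto simp: U_def)
      have coord: "\<bar>(x - y) \<bullet> i\<bar> \<le> 2 * M / real N" if i: "i \<in> B" for i
      proof -
        have "\<bar>(x \<bullet> i + M) / (2 * M) - (y \<bullet> i + M) / (2 * M)\<bar> \<le> real (Suc (\<kappa> i)) / real N - real (\<kappa> i) / real N"
          using xb yb i by (intro abs_leI) (smt (verit))+
        also have "\<dots> = 1 / real N" using N by (simp add: field_simps)
        also have "(x \<bullet> i + M) / (2 * M) - (y \<bullet> i + M) / (2 * M) = ((x - y) \<bullet> i) / (2 * M)"
          by (simp add: inner_diff_left diff_divide_distrib[symmetric])
        finally have "\<bar>(x - y) \<bullet> i\<bar> / (2 * M) \<le> 1 / real N" using M by simp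
        then show ?thesis using M by (simp add: pos_divide_le_eq)
      qed
      have "dist x y \<le> (\<Sum>i\<in>Basis. \<bar>(x - y) \<bullet> i\<bar>)" unfolding dist_norm by (rule norm_le_l1)
      also have "\<dots> = (\<Sum>i\<in>B. \<bar>(x - y) \<bullet> i\<bar>)"
        using B flat[OF x(1) y(1)] by (intro sum.mono_neutral_right) (auto simp: inner_diff_left)
      also have "\<dots> \<le> real ?d * (2 * M / real N)"
        using sum_bounded_above[of B "\<lambda>i. \<bar>(x - y) \<bullet> i\<bar>" "2 * M / real N"] coord by simp
      finally have "dist x y \<le> real ?d * (2 * M / real N)" .
      then have "L * dist x y \<le> C / real N"
        using L mult_left_mono[of "dist x y" "real ?d * (2 * M / real N)" L] by (simp add: C_def)
      then show ?thesis using lip[OF x(1) y(1)] x y by simp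
    qed
    have diam: "diameter (U \<kappa>) \<le> C / real N" for \<kappa>
      using dist_U[of _ \<kappa>] C0 by (intro diameter_le) (auto simp: dist_norm)
    have bdd: "bounded (U \<kappa>)" for \<kappa>
      unfolding bounded_two_points using dist_U by blast
    have "hausdorff_premeasure m \<delta> (f ` A) \<le> (\<Sum>\<kappa>\<in>I. hausdorff_weight m (U \<kappa>))"
    proof (rule hausdorff_premeasure_le_finite[OF finI \<delta>0])
      show "f ` A \<subseteq> (\<Union>\<kappa>\<in>I. U \<kappa>)"
      proof
        fix p assume "p \<in> f ` A"
        then obtain x where x: "x \<in> A" "p = f x" by blast
        have "\<exists>k<N. real k / real N \<le> (x \<bullet> i + M) / (2 * M) \<and> (x \<bullet> i + M) / (2 * M) \<le> real (Suc k) / real N"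
          if "i \<in> B" for i
          using box[OF x(1) that] M N by (intro unit_interval_subdivision) (auto simp: field_simps)
        then obtain k where k: "\<And>i. i \<in> B \<Longrightarrow> k i < N \<and> real (k i) / real N \<le> (x \<bullet> i + M) / (2 * M)
            \<and> (x \<bullet> i + M) / (2 * M) \<le> real (Suc (k i)) / real N"
          by metis
        have "p \<in> U (restrict k B)" using x k by (auto simp: U_def)
        moreover have "restrict k B \<in> I" using k by (auto simp: I_def)
        ultimately show "p \<in> (\<Union>\<kappa>\<in>I. U \<kappa>)" by blast
      qed
    qed (use bdd diam \<delta> in \<open>auto intro: order_trans\<close>)
    also have "\<dots> \<le> (\<Sum>\<kappa>\<in>I. ennreal (unit_ball_vol (real m) * (C / real N / 2) ^ m))"
    proof (rule sum_mono)
      fix \<kappa>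
      have "unit_ball_vol (real m) * (diameter (U \<kappa>) / 2) ^ m
          \<le> unit_ball_vol (real m) * (C / real N / 2) ^ m"
        using diam[of \<kappa>] diameter_ge_0[OF bdd, of \<kappa>]
        by (intro mult_left_mono power_mono divide_right_mono) auto
      then show "hausdorff_weight m (U \<kappa>) \<le> ennreal (unit_ball_vol (real m) * (C / real N / 2) ^ m)"
        by (auto simp: hausdorff_weight_def intro: ennreal_leI)
    qed
    also have "\<dots> = ennreal (real (N ^ ?d) * (unit_ball_vol (real m) * (C / real N / 2) ^ m))"
      by (simp add: cardI ennreal_mult' ennreal_of_nat_eq_real_of_nat del: of_nat_power)
    finally show ?thesis .
  qed
  have big: "\<exists>N>0. C / real N \<le> \<delta> \<and> K / real N \<le> \<epsilon>" if "\<delta> > 0" "\<epsilon> > 0" for \<delta> \<epsilon> K :: real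
  proof -
    obtain N :: nat where N: "max (max (C / \<delta>) (K / \<epsilon>)) 0 < real N" using reals_Archimedean2 by blast
    then have "0 < N" "C / \<delta> < real N" "K / \<epsilon> < real N" by auto
    then show ?thesis using that by (intro exI[of _ N]) (auto simp: field_simps)
  qed
  have "hausdorff_outer ?d (f ` A) \<le> ennreal (unit_ball_vol (real ?d) * (C / 2) ^ ?d)"
    unfolding hausdorff_outer_def
  proof (rule SUP_least)
    fix \<delta> :: real assume "\<delta> \<in> {0<..}"
    then obtain N where N: "N > 0" "C / real N \<le> \<delta>" using big[of \<delta> 1] by auto
    have eq: "real (N ^ ?d) * (unit_ball_vol (real ?d) * (C / real N / 2) ^ ?d) = unit_ball_vol (real ?d) * (C / 2) ^ ?d"
      using N by (simp add: power_divide)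
    then show "hausdorff_premeasure ?d \<delta> (f ` A) \<le> ennreal (unit_ball_vol (real ?d) * (C / 2) ^ ?d)"
      using main[OF N, of ?d] by (simp only: eq)
  qed
  then show "hausdorff_outer ?d (f ` A) < \<infinity>"
    by (simp add: order_le_less_trans)
  have "hausdorff_outer (Suc ?d) (f ` A) \<le> 0"
    unfolding hausdorff_outer_def
  proof (rule SUP_least)
    fix \<delta> :: real assume \<delta>: "\<delta> \<in> {0<..}"
    show "hausdorff_premeasure (Suc ?d) \<delta> (f ` A) \<le> 0"
    proof (rule ennreal_le_epsilon)
      fix e :: real assume e: "e > 0"
      define K where "K = unit_ball_vol (real (Suc ?d)) * (C / 2) ^ Suc ?d"
      obtain N where N: "N > 0" "C / real N \<le> \<delta>" "K / real N \<le> e" using big[of \<delta> e K] \<delta> e by auto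
      have "real (N ^ ?d) * (unit_ball_vol (real (Suc ?d)) * (C / real N / 2) ^ Suc ?d) = K / real N"
        using N by (simp add: power_divide K_def field_simps)
      then show "hausdorff_premeasure (Suc ?d) \<delta> (f ` A) \<le> 0 + ennreal e"
        using order_trans[OF main[OF N(1,2), of "Suc ?d"] ennreal_leI] N(3) by simp
    qed
  qed
  then show "hausdorff_outer (Suc ?d) (f ` A) = 0" by simp
qed

lemma dist_normalize_le:
  fixes x y :: "'a::euclidean_space"
  assumes "r > 0" "norm x \<ge> r" "norm y \<ge> r"
  shows "dist (x /\<^sub>R norm x) (y /\<^sub>R norm y) \<le> 2 / r * dist x y"
proof -
  have x0: "norm x > 0" and y0: "norm y > 0" using assms by linarith+
  have "x /\<^sub>R norm x - y /\<^sub>R norm y = (x - y) /\<^sub>R norm x + ((norm y - norm x) / (norm x * norm y)) *\<^sub>R y"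
  proof -
    have "inverse (norm x) = inverse (norm y) + (norm y - norm x) / (norm x * norm y)"
      using x0 y0 by (simp add: field_simps)
    then have "y /\<^sub>R norm x = y /\<^sub>R norm y + ((norm y - norm x) / (norm x * norm y)) *\<^sub>R y"
      by (metis scaleR_left_distrib)
    then show ?thesis by (simp add: scaleR_right_diff_distrib)
  qed
  then have "dist (x /\<^sub>R norm x) (y /\<^sub>R norm y)
      \<le> norm ((x - y) /\<^sub>R norm x) + norm (((norm y - norm x) / (norm x * norm y)) *\<^sub>R y)"
    unfolding dist_norm by (metis norm_triangle_ineq)
  also have "\<dots> = norm (x - y) / norm x + \<bar>norm y - norm x\<bar> / norm x"
    using x0 y0 by (simp add: divide_inverse abs_mult)
  also have "\<dots> \<le> norm (x - y) / r + norm (x - y) / r"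
    using assms x0 norm_triangle_ineq3[of y x]
    by (intro add_mono frac_le) (auto simp: norm_minus_commute)
  finally show ?thesis by (simp add: dist_norm)
qed

text \<open>
  The sphere is the radial projection of the boundary of a cube, and this projection is Lipschitz
  on each of the finitely many faces.
\<close>
lemma hausdorff_outer_sphere_finite:
  "hausdorff_outer (DIM('a) - 1) (sphere 0 1 :: 'a::euclidean_space set) < \<infinity>"
proof -
  let ?n = "\<lambda>x :: 'a. x /\<^sub>R norm x"
  define Face where "Face i s = {x :: 'a. x \<bullet> i = s \<and> (\<forall>j\<in>Basis. \<bar>x \<bullet> j\<bar> \<le> 1)}" for i s
  have fin: "hausdorff_outer (DIM('a) - 1) (?n ` Face i s) < \<infinity>"
    if i: "i \<in> Basis" and s: "\<bar>s\<bar> = 1" for i s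
  proof -
    have n1: "norm x \<ge> 1" if "x \<in> Face i s" for x
      using Basis_le_norm[OF i, of x] that s by (auto simp: Face_def)
    have lip: "dist (?n x) (?n y) \<le> 2 / 1 * dist x y" if "x \<in> Face i s" "y \<in> Face i s" for x y
      using that by (intro dist_normalize_le n1) auto
    have "hausdorff_outer (card (Basis - {i})) (?n ` Face i s) < \<infinity>"
      by (rule hausdorff_outer_lipschitz_image_finite[OF _ _ _ lip, where M = 1])
        (auto simp: Face_def)
    then show ?thesis using i by (simp add: card_Diff_singleton)
  qed
  have cover: "sphere 0 1 \<subseteq> (\<Union>(i,s)\<in>Basis \<times> {-1,1}. ?n ` Face i s)"
  proof
    fix u :: 'a assume u: "u \<in> sphere 0 1"
    obtain i where i: "i \<in> Basis" "\<And>j. j \<in> Basis \<Longrightarrow> \<bar>u \<bullet> j\<bar> \<le> \<bar>u \<bullet> i\<bar>"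
    proof -
      let ?S = "(\<lambda>i. \<bar>u \<bullet> i\<bar>) ` Basis"
      have "Max ?S \<in> ?S" by (rule Max_in) auto
      then obtain i where i: "Max ?S = \<bar>u \<bullet> i\<bar>" "i \<in> Basis" by (rule imageE)
      have le: "\<bar>u \<bullet> j\<bar> \<le> \<bar>u \<bullet> i\<bar>" if j: "j \<in> Basis" for j
        unfolding i(1)[symmetric] by (intro Max_ge finite_imageI finite_Basis imageI j)
      show ?thesis by (rule that[OF i(2) le])
    qed
    have pos: "\<bar>u \<bullet> i\<bar> > 0"
    proof (rule ccontr)
      assume *: "\<not> \<bar>u \<bullet> i\<bar> > 0"
      have "u = 0"
      proof (rule euclidean_eqI)
        fix j :: 'a assume "j \<in> Basis"
        then show "u \<bullet> j = 0 \<bullet> j" using i(2)[of j] * by simp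
      qed
      with u show False by simp
    qed
    define x where "x = u /\<^sub>R \<bar>u \<bullet> i\<bar>"
    have "x \<in> Face i (sgn (u \<bullet> i))"
      using i pos by (auto simp: Face_def x_def sgn_if abs_mult divide_simps)
    moreover have "u = ?n x" using u pos by (simp add: x_def)
    moreover have "sgn (u \<bullet> i) \<in> {-1,1}" using pos by (auto simp: sgn_if)
    ultimately show "u \<in> (\<Union>(i,s)\<in>Basis \<times> {-1,1}. ?n ` Face i s)"
      using i by blast
  qed
  have UN_fin: "hausdorff_outer d (\<Union>k\<in>I. V k) < \<infinity>"
    if "finite I" "\<And>k. k \<in> I \<Longrightarrow> hausdorff_outer d (V k) < \<infinity>" for I :: "('a \<times> real) set" and V :: "_ \<Rightarrow> 'a set" and d
    using that
  proof (induction I)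
    case (insert k I)
    then have "hausdorff_outer d (V k) + hausdorff_outer d (\<Union>k\<in>I. V k) < \<infinity>" by simp
    then show ?case using hausdorff_outer_Un_le[of d "V k" "\<Union>k\<in>I. V k"] by (simp add: order_le_less_trans)
  qed simp
  have "hausdorff_outer (DIM('a) - 1) (\<Union>(i,s)\<in>Basis \<times> {-1,1}. ?n ` Face i s) < \<infinity>"
    by (rule UN_fin) (use fin[of _ 1] fin[of _ "-1"] in auto)
  then show ?thesis
    using hausdorff_outer_mono[OF cover, of "DIM('a) - 1"] by (simp add: order_le_less_trans)
qed

lemma sphere_in_sets: "sphere 0 1 \<in> sets (hausdorff_measure d :: 'a::euclidean_space measure)"
  by (intro closed_in_sets_hausdorff_measure) auto

lemma integrable_on_sphere:
  fixes f :: "'a::euclidean_space \<Rightarrow> real"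
  assumes f: "f \<in> borel_measurable sphere_measure"
    and bdd: "AE u in sphere_measure. \<bar>f u\<bar> \<le> B * indicator (sphere 0 1) u"
  shows "integrable sphere_measure f"
proof (rule Bochner_Integration.integrable_bound[OF _ f])
  have "emeasure sphere_measure (sphere 0 1 :: 'a set) < \<infinity>"
    using hausdorff_outer_sphere_finite[where 'a='a] by (simp add: emeasure_hausdorff_measure sphere_in_sets)
  then show "integrable sphere_measure (\<lambda>u :: 'a. B * indicator (sphere 0 1) u)"
    using sphere_in_sets[where 'a='a] by (intro integrable_mult_right integrable_real_indicator) auto
  show "AE u in sphere_measure. norm (f u) \<le> norm (B * indicator (sphere 0 1) u)"
    using bdd by eventually_elim auto
qed

section \<open>Boundary points with several normals\<close>

text \<open>
  The normal cone at \<open>x\<close>, translated to \<open>x\<close>, is contained in the fibre of the nearest-point map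
  over \<open>x\<close>.
\<close>
lemma closest_point_add_normals:
  fixes x v w :: "'a::euclidean_space"
  assumes K: "convex K" "closed K" "x \<in> K"
    and v: "\<And>z. z \<in> K \<Longrightarrow> z \<bullet> v \<le> x \<bullet> v" and w: "\<And>z. z \<in> K \<Longrightarrow> z \<bullet> w \<le> x \<bullet> w"
    and "s \<ge> 0" "t \<ge> 0"
  shows "closest_point K (x + s *\<^sub>R v + t *\<^sub>R w) = x"
proof -
  let ?n = "s *\<^sub>R v + t *\<^sub>R w"
  have "dist (x + ?n) x \<le> dist (x + ?n) z" if z: "z \<in> K" for z
  proof -
    have "s * (z \<bullet> v) \<le> s * (x \<bullet> v)" "t * (z \<bullet> w) \<le> t * (x \<bullet> w)"
      using v[OF z] w[OF z] assms by (auto intro: mult_left_mono)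
    then have "0 \<le> ?n \<bullet> (x - z)"
      by (simp add: inner_diff_right inner_add_left inner_commute[of v] inner_commute[of w])
    then have "?n \<bullet> ?n \<le> (?n + (x - z)) \<bullet> (?n + (x - z))"
      using inner_ge_zero[of "x - z"]
      by (subst inner_add_left, subst (1 2) inner_add_right, subst inner_commute[of "x - z" ?n]) linarith
    then have "norm ?n \<le> norm (?n + (x - z))" unfolding norm_le .
    then show ?thesis by (simp add: dist_norm algebra_simps)
  qed
  then have "x = closest_point K (x + ?n)"
    using K by (intro closest_point_unique) auto
  then show ?thesis by (simp add: add.assoc)
qed

lemma nonparallel_minor:
  fixes v w :: "'a::euclidean_space"
  assumes "norm v = 1" "norm w = 1" "v \<noteq> w" "v \<noteq> - w"
  obtains i j where "i \<in> Basis" "j \<in> Basis" "(v \<bullet> i) * (w \<bullet> j) \<noteq> (v \<bullet> j) * (w \<bullet> i)"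
proof (rule ccontr)
  assume "\<not> thesis"
  with that have eq: "(v \<bullet> i) * (w \<bullet> j) = (v \<bullet> j) * (w \<bullet> i)" if "i \<in> Basis" "j \<in> Basis" for i j
    using that by blast
  have "v \<noteq> 0" using assms by auto
  then obtain i where i: "i \<in> Basis" "v \<bullet> i \<noteq> 0" using euclidean_all_zero_iff by blast
  define c where "c = (w \<bullet> i) / (v \<bullet> i)"
  have w: "w = c *\<^sub>R v"
  proof (rule euclidean_eqI)
    fix j :: 'a assume "j \<in> Basis"
    then show "w \<bullet> j = (c *\<^sub>R v) \<bullet> j"
      using eq[OF i(1), of j] i by (simp add: c_def field_simps)
  qed
  then have "\<bar>c\<bar> = 1" using assms by simp
  then show False using w assms by (auto simp: abs_if split: if_splits)
qed

text \<open>
  If \<open>v\<close> and \<open>w\<close> are two normals at \<open>x\<close>, some coordinate minor of \<open>v, w\<close> is non-zero, say for the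
  coordinates \<open>i, j\<close>. Then \<open>(s, t) \<mapsto> x + s v + t w\<close> maps onto all values of the coordinates
  \<open>i, j\<close> near those of \<open>x + v + w\<close>, with \<open>s\<close> and \<open>t\<close> non-negative. So it hits a plane on which
  these two coordinates are rational constants, and \<open>x\<close> is the nearest point of that intersection
  point. There are countably many such planes, and each of them has dimension \<open>n - 2\<close>.
\<close>
theorem nonunique_normal_directions_null:
  fixes K :: "'a::euclidean_space set"
  assumes K: "convex K" "closed K" and r: "r > 0" and ball: "cball 0 r \<subseteq> K"
  shows "{x /\<^sub>R norm x | x. x \<in> K \<and> r \<le> norm x \<and> (\<exists>v w. norm v = 1 \<and> norm w = 1 \<and> v \<noteq> w \<and>
      (\<forall>z\<in>K. z \<bullet> v \<le> x \<bullet> v) \<and> (\<forall>z\<in>K. z \<bullet> w \<le> x \<bullet> w))} \<in> null_sets (sphere_measure :: 'a measure)"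
proof (rule null_sets_hausdorff_measure_subset)
  define A :: "'a \<times> 'a \<Rightarrow> rat \<times> rat \<times> nat \<Rightarrow> 'a set"
    where "A = (\<lambda>(i,j) (p,q,N). {y. y \<bullet> i = of_rat p \<and> y \<bullet> j = of_rat q \<and>
      (\<forall>k\<in>Basis. \<bar>y \<bullet> k\<bar> \<le> real (Suc N)) \<and> r \<le> norm (closest_point K y)})"
  define f where "f y = closest_point K y /\<^sub>R norm (closest_point K y)" for y
  define I where "I = {(i::'a, j::'a). i \<in> Basis \<and> j \<in> Basis \<and> i \<noteq> j}"
  have I: "finite I" unfolding I_def by (rule finite_subset[of _ "Basis \<times> Basis"]) auto
  have ne: "K \<noteq> {}" using ball r by auto
  have null: "f ` A ij pqN \<in> null_sets (sphere_measure :: 'a measure)" if ij: "ij \<in> I" for ij pqN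
  proof (rule null_sets_hausdorff_measureI)
    obtain i j where ij': "ij = (i, j)" "i \<in> Basis" "j \<in> Basis" "i \<noteq> j" using ij by (auto simp: I_def)
    obtain p q N where pqN: "pqN = (p, q, N)" by (cases pqN) auto
    have lip: "dist (f x) (f y) \<le> 2 / r * dist x y" if "x \<in> A ij pqN" "y \<in> A ij pqN" for x y
    proof -
      have "dist (f x) (f y) \<le> 2 / r * dist (closest_point K x) (closest_point K y)"
        unfolding f_def using that r by (intro dist_normalize_le) (auto simp: A_def ij' pqN)
      also have "\<dots> \<le> 2 / r * dist x y"
        using r closest_point_lipschitz[OF K ne] by (intro mult_left_mono) auto
      finally show ?thesis .
    qed
    have "hausdorff_outer (Suc (card (Basis - {i, j}))) (f ` A ij pqN) = 0"
      by (rule hausdorff_outer_lipschitz_image_null[OF _ _ _ lip, where M = "real (Suc N)"])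
        (use r in \<open>auto simp: A_def ij' pqN\<close>)
    moreover have "card {i, j} \<le> DIM('a)"
      using ij' by (intro card_mono) auto
    then have "Suc (card (Basis - {i, j})) = DIM('a) - 1"
      using ij' by (simp add: card_Diff_subset)
    ultimately show "hausdorff_outer (DIM('a) - 1) (f ` A ij pqN) = 0" by simp
  qed
  show "(\<Union>ij\<in>I. \<Union>pqN. f ` A ij pqN) \<in> null_sets (sphere_measure :: 'a measure)"
    using I null by (intro null_sets_UN' null_sets_UN countable_finite) auto
  show "{x /\<^sub>R norm x | x. x \<in> K \<and> r \<le> norm x \<and> (\<exists>v w. norm v = 1 \<and> norm w = 1 \<and> v \<noteq> w \<and>
      (\<forall>z\<in>K. z \<bullet> v \<le> x \<bullet> v) \<and> (\<forall>z\<in>K. z \<bullet> w \<le> x \<bullet> w))} \<subseteq> (\<Union>ij\<in>I. \<Union>pqN. f ` A ij pqN)"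
  proof clarify
    fix x v w assume x: "x \<in> K" "r \<le> norm x" and vw: "norm v = 1" "norm w = 1" "v \<noteq> w"
      and v: "\<forall>z\<in>K. z \<bullet> v \<le> x \<bullet> v" and w: "\<forall>z\<in>K. z \<bullet> w \<le> x \<bullet> w"
    have "v \<noteq> - w"
    proof
      assume eq: "v = - w"
      have "r *\<^sub>R v \<in> K" "r *\<^sub>R w \<in> K" using r vw ball by (auto simp: subset_iff)
      with v w have "(r *\<^sub>R v) \<bullet> v \<le> x \<bullet> v" "(r *\<^sub>R w) \<bullet> w \<le> x \<bullet> w" by auto
      moreover have "v \<bullet> v = 1" "w \<bullet> w = 1" using vw by (simp_all add: norm_eq_1)
      ultimately show False using r eq by simp
    qed
    with vw obtain i j where ij: "i \<in> Basis" "j \<in> Basis" and minor: "(v \<bullet> i) * (w \<bullet> j) \<noteq> (v \<bullet> j) * (w \<bullet> i)"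
      by (rule nonparallel_minor)
    define D where "D = (v \<bullet> i) * (w \<bullet> j) - (v \<bullet> j) * (w \<bullet> i)"
    \<comment> \<open>Cramer's rule divides by \<open>D\<close>. Moving the two coordinates by at most \<open>\<eta>\<close> changes \<open>s\<close> and \<open>t\<close>
      by at most \<open>2 * \<eta> / \<bar>D\<bar> < 1\<close>, so both stay non-negative.\<close>
    define \<eta> where "\<eta> = \<bar>D\<bar> / 4"
    have \<eta>: "\<eta> > 0" using minor by (simp add: \<eta>_def D_def)
    have D0: "D \<noteq> 0" using minor by (simp add: D_def)
    obtain p :: rat where p: "x \<bullet> i + v \<bullet> i + w \<bullet> i - \<eta> < of_rat p" "of_rat p < x \<bullet> i + v \<bullet> i + w \<bullet> i + \<eta>"
      using of_rat_dense[of "x \<bullet> i + v \<bullet> i + w \<bullet> i - \<eta>" "x \<bullet> i + v \<bullet> i + w \<bullet> i + \<eta>"] \<eta> by auto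
    obtain q :: rat where q: "x \<bullet> j + v \<bullet> j + w \<bullet> j - \<eta> < of_rat q" "of_rat q < x \<bullet> j + v \<bullet> j + w \<bullet> j + \<eta>"
      using of_rat_dense[of "x \<bullet> j + v \<bullet> j + w \<bullet> j - \<eta>" "x \<bullet> j + v \<bullet> j + w \<bullet> j + \<eta>"] \<eta> by auto
    define a where "a = of_rat p - (x \<bullet> i + v \<bullet> i + w \<bullet> i)"
    define b where "b = of_rat q - (x \<bullet> j + v \<bullet> j + w \<bullet> j)"
    have ab: "\<bar>a\<bar> \<le> \<eta>" "\<bar>b\<bar> \<le> \<eta>" using p q by (auto simp: a_def b_def)
    define s where "s = 1 + (a * (w \<bullet> j) - b * (w \<bullet> i)) / D"
    define t where "t = 1 + (b * (v \<bullet> i) - a * (v \<bullet> j)) / D"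
    have coef: "\<bar>(c * (z \<bullet> k) - d * (z \<bullet> l)) / D\<bar> \<le> 1"
      if "\<bar>c\<bar> \<le> \<eta>" "\<bar>d\<bar> \<le> \<eta>" "norm z = 1" "k \<in> Basis" "l \<in> Basis" for c d z k l
    proof -
      have "\<bar>z \<bullet> k\<bar> \<le> 1" "\<bar>z \<bullet> l\<bar> \<le> 1" using that Basis_le_norm[of _ z] by auto
      then have "\<bar>c * (z \<bullet> k)\<bar> \<le> \<eta> * 1" "\<bar>d * (z \<bullet> l)\<bar> \<le> \<eta> * 1"
        unfolding abs_mult using that by (intro mult_mono; auto)+
      then have "\<bar>c * (z \<bullet> k) - d * (z \<bullet> l)\<bar> \<le> \<bar>D\<bar>" using \<eta> unfolding \<eta>_def by linarith
      then show ?thesis using D0 by (simp add: abs_divide)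
    qed
    have st: "s \<ge> 0" "t \<ge> 0"
      using coef[OF ab vw(2) ij(2,1)] coef[OF ab(2,1) vw(1) ij] unfolding s_def t_def by linarith+
    define y where "y = x + s *\<^sub>R v + t *\<^sub>R w"
    have cp: "closest_point K y = x"
      unfolding y_def using K x st v w by (intro closest_point_add_normals) auto
    have yi: "y \<bullet> i = of_rat p"
    proof -
      have "D * (y \<bullet> i) = D * (x \<bullet> i) + (D * s) * (v \<bullet> i) + (D * t) * (w \<bullet> i)"
        by (simp add: y_def inner_add_left algebra_simps)
      also have "D * s = D + (a * (w \<bullet> j) - b * (w \<bullet> i))" using D0 by (simp add: s_def distrib_left)
      also have "D * t = D + (b * (v \<bullet> i) - a * (v \<bullet> j))" using D0 by (simp add: t_def distrib_left)
      also have "D * (x \<bullet> i) + (D + (a * (w \<bullet> j) - b * (w \<bullet> i))) * (v \<bullet> i)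
          + (D + (b * (v \<bullet> i) - a * (v \<bullet> j))) * (w \<bullet> i) = D * (x \<bullet> i + v \<bullet> i + w \<bullet> i + a)"
        by (simp add: D_def algebra_simps)
      finally show ?thesis using D0 by (simp add: a_def)
    qed
    have yj: "y \<bullet> j = of_rat q"
    proof -
      have "D * (y \<bullet> j) = D * (x \<bullet> j) + (D * s) * (v \<bullet> j) + (D * t) * (w \<bullet> j)"
        by (simp add: y_def inner_add_left algebra_simps)
      also have "D * s = D + (a * (w \<bullet> j) - b * (w \<bullet> i))" using D0 by (simp add: s_def distrib_left)
      also have "D * t = D + (b * (v \<bullet> i) - a * (v \<bullet> j))" using D0 by (simp add: t_def distrib_left)
      also have "D * (x \<bullet> j) + (D + (a * (w \<bullet> j) - b * (w \<bullet> i))) * (v \<bullet> j)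
          + (D + (b * (v \<bullet> i) - a * (v \<bullet> j))) * (w \<bullet> j) = D * (x \<bullet> j + v \<bullet> j + w \<bullet> j + b)"
        by (simp add: D_def algebra_simps)
      finally show ?thesis using D0 by (simp add: b_def)
    qed
    obtain N :: nat where N: "norm y \<le> real N" using real_arch_simple by blast
    have "\<bar>y \<bullet> k\<bar> \<le> real (Suc N)" if "k \<in> Basis" for k
      using Basis_le_norm[OF that, of y] N by simp
    then have "y \<in> A (i, j) (p, q, N)" using yi yj cp x by (simp add: A_def)
    moreover have "(i, j) \<in> I" using ij minor by (auto simp: I_def)
    moreover have "f y = x /\<^sub>R norm x" by (simp add: f_def cp)
    ultimately show "x /\<^sub>R norm x \<in> (\<Union>ij\<in>I. \<Union>pqN. f ` A ij pqN)" by force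
  qed
qed

section \<open>Integrals against signed image measures\<close>

text \<open>
  For a difference of finite measures with Hahn set \<open>Y\<close>, the supremum defining the positive
  variation of \<open>E\<close> is attained at \<open>E \<inter> Y\<close>.
\<close>
lemma pos_variation_diff:
  assumes M1: "finite_measure M1" "sets M1 = sets M" and M2: "finite_measure M2" "sets M2 = sets M"
    and \<mu>: "\<And>E. E \<in> sets M \<Longrightarrow> \<mu> E = measure M1 E - measure M2 E"
    and Y: "Y \<in> sets M"
    and posY: "\<And>X. X \<in> sets M \<Longrightarrow> X \<subseteq> Y \<Longrightarrow> emeasure M2 X \<le> emeasure M1 X"
    and negY: "\<And>X. X \<in> sets M \<Longrightarrow> X \<inter> Y = {} \<Longrightarrow> emeasure M1 X \<le> emeasure M2 X"
  shows "sets (pos_variation M \<mu>) = sets M"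
    and "finite_measure (pos_variation M \<mu>)"
    and "\<And>E. E \<in> sets M \<Longrightarrow> measure (pos_variation M \<mu>) E = measure M1 (E \<inter> Y) - measure M2 (E \<inter> Y)"
proof -
  interpret M1: finite_measure M1 by fact
  interpret M2: finite_measure M2 by fact
  define N1 where "N1 = density M1 (indicator Y)"
  define N2 where "N2 = density M2 (indicator Y)"
  have N1: "emeasure N1 E = emeasure M1 (E \<inter> Y)" and N2: "emeasure N2 E = emeasure M2 (E \<inter> Y)"
    if "E \<in> sets M" for E
    using that Y M1 M2 by (auto simp: N1_def N2_def emeasure_density nn_integral_indicator
        simp flip: indicator_inter_arith intro!: arg_cong[of _ _ "emeasure _"])
  have sp: "space M1 = space M" "space M2 = space M" using M1 M2 sets_eq_imp_space_eq by blast+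
  have fin: "finite_measure N1" "finite_measure N2"
    using Y by (auto intro!: finite_measureI simp: N1 N2 N1_def[THEN arg_cong[of _ _ space]] N2_def[THEN arg_cong[of _ _ space]] sp)
  define p where "p = diff_measure N1 N2"
  have setsN: "sets N1 = sets M" "sets N2 = sets M" using M1 M2 by (auto simp: N1_def N2_def)
  have p: "emeasure p E = emeasure M1 (E \<inter> Y) - emeasure M2 (E \<inter> Y)" if E: "E \<in> sets M" for E
    unfolding p_def using fin setsN E Y posY by (subst emeasure_diff_measure) (auto simp: N1 N2)
  have p': "emeasure p E = ennreal (\<mu> (E \<inter> Y))" if E: "E \<in> sets M" for E
    unfolding p[OF E] using E Y \<mu>[of "E \<inter> Y"]
    by (simp add: M1.emeasure_eq_measure M2.emeasure_eq_measure ennreal_minus)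
  have mono: "measure M2 X \<le> measure M1 X" if "X \<in> sets M" "X \<subseteq> Y" for X
    using posY[OF that] by (simp add: M1.emeasure_eq_measure M2.emeasure_eq_measure)
  have mono': "measure M1 X \<le> measure M2 X" if "X \<in> sets M" "X \<inter> Y = {}" for X
    using negY[OF that] by (simp add: M1.emeasure_eq_measure M2.emeasure_eq_measure)
  have split: "\<mu> F = \<mu> (F \<inter> Y) + \<mu> (F - Y)" if F: "F \<in> sets M" for F
  proof -
    have "(F \<inter> Y) \<union> (F - Y) = F" by blast
    then have "measure N F = measure N (F \<inter> Y) + measure N (F - Y)"
      if "finite_measure N" "sets N = sets M" for N
      using finite_measure.finite_measure_Union[OF that(1), of "F \<inter> Y" "F - Y"] that(2) F Y by auto
    note this[OF M1] this[OF M2]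
    with F Y show ?thesis by (simp add: \<mu>)
  qed
  have sup: "(SUP F\<in>{F \<in> sets M. F \<subseteq> E}. ennreal (\<mu> F)) = emeasure p E" if E: "E \<in> sets M" for E
  proof (rule antisym)
    show "(SUP F\<in>{F \<in> sets M. F \<subseteq> E}. ennreal (\<mu> F)) \<le> emeasure p E"
    proof (rule SUP_least, clarify)
      fix F assume F: "F \<in> sets M" "F \<subseteq> E"
      have "\<mu> (F - Y) \<le> 0" using mono'[of "F - Y"] F Y by (auto simp: \<mu>)
      moreover have "\<mu> (E \<inter> Y - F) \<ge> 0" using mono[of "E \<inter> Y - F"] E F Y by (auto simp: \<mu>)
      moreover have "\<mu> (E \<inter> Y) = \<mu> (F \<inter> Y) + \<mu> (E \<inter> Y - F)"
      proof -
        have "F \<inter> Y \<subseteq> E \<inter> Y" "E \<inter> Y - F \<inter> Y = E \<inter> Y - F" using F by auto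
        then have "measure M1 (E \<inter> Y - F) = measure M1 (E \<inter> Y) - measure M1 (F \<inter> Y)"
          "measure M2 (E \<inter> Y - F) = measure M2 (E \<inter> Y) - measure M2 (F \<inter> Y)"
          using M1.finite_measure_Diff[of "E \<inter> Y" "F \<inter> Y"] M2.finite_measure_Diff[of "E \<inter> Y" "F \<inter> Y"]
            E F Y M1 M2 by auto
        then show ?thesis using E F Y by (simp add: \<mu>)
      qed
      ultimately show "ennreal (\<mu> F) \<le> emeasure p E"
        using split[OF F(1)] by (simp add: p'[OF E] ennreal_leI)
    qed
    show "emeasure p E \<le> (SUP F\<in>{F \<in> sets M. F \<subseteq> E}. ennreal (\<mu> F))"
      unfolding p'[OF E] using E Y by (intro SUP_upper) auto
  qed
  have "pos_variation M \<mu> = measure_of (space M) (sets M) (emeasure p)"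
    unfolding pos_variation_def by (intro measure_of_eq sets.space_closed) (simp add: sets.sigma_sets_eq sup)
  also have "\<dots> = p"
    using measure_of_of_measure[of p] setsN sp by (simp add: p_def N1_def)
  finally have eq: "pos_variation M \<mu> = p" .
  show "sets (pos_variation M \<mu>) = sets M" unfolding eq by (simp add: p_def setsN)
  show "finite_measure (pos_variation M \<mu>)"
    unfolding eq using p'[of "space M"] by (intro finite_measureI) (simp add: p_def N1_def sp)
  show "measure (pos_variation M \<mu>) E = measure M1 (E \<inter> Y) - measure M2 (E \<inter> Y)" if E: "E \<in> sets M" for E
    unfolding eq measure_def[of p] p'[OF E] using mono[of "E \<inter> Y"] E Y by (simp add: \<mu> enn2real_ennreal)
qed

text \<open>
  Equations between sums of measures are used in place of differences: no subtraction in
  \<^typ>\<open>ennreal\<close> occurs, and the induction on the integrand goes through unchanged.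
\<close>
lemma nn_integral_eq_of_emeasure_add_eq:
  fixes f :: "'a \<Rightarrow> ennreal"
  assumes sets: "sets P = sets M" "sets Q = sets M" "sets R = sets M" "sets S = sets M"
    and eq: "\<And>E. E \<in> sets M \<Longrightarrow> emeasure P E + emeasure Q E = emeasure R E + emeasure S E"
    and f: "f \<in> borel_measurable M"
  shows "nn_integral P f + nn_integral Q f = nn_integral R f + nn_integral S f"
  using f
proof (induction rule: borel_measurable_induct)
  case (cong f g)
  have "nn_integral N f = nn_integral N g" if "sets N = sets M" for N
    using cong(3) sets_eq_imp_space_eq[OF that] by (intro nn_integral_cong) auto
  then show ?case using cong(4) sets by simp
next
  case (set A)
  then show ?case using eq[OF set] sets by (simp add: nn_integral_indicator)
next
  case (mult u c)
  then have "u \<in> borel_measurable N" if "sets N = sets M" for N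
    using measurable_cong_sets[OF that refl, of borel] by auto
  then have "(\<integral>\<^sup>+x. c * u x \<partial>N) = c * nn_integral N u" if "sets N = sets M" for N
    using that by (intro nn_integral_cmult) auto
  then show ?case using mult(4) sets by (simp add: distrib_left[symmetric])
next
  case (add u v)
  then have "u \<in> borel_measurable N" "v \<in> borel_measurable N" if "sets N = sets M" for N
    using measurable_cong_sets[OF that refl, of borel] by auto
  then have "(\<integral>\<^sup>+x. v x + u x \<partial>N) = nn_integral N v + nn_integral N u" if "sets N = sets M" for N
    using that by (intro nn_integral_add) auto
  then have "(\<integral>\<^sup>+x. v x + u x \<partial>P) + (\<integral>\<^sup>+x. v x + u x \<partial>Q)
      = (nn_integral P v + nn_integral Q v) + (nn_integral P u + nn_integral Q u)"
    "(\<integral>\<^sup>+x. v x + u x \<partial>R) + (\<integral>\<^sup>+x. v x + u x \<partial>S)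
      = (nn_integral R v + nn_integral S v) + (nn_integral R u + nn_integral S u)"
    using sets by (simp_all add: ac_simps)
  then show ?case using add.IH by simp
next
  case (seq U)
  then have "U i \<in> borel_measurable N" if "sets N = sets M" for N i
    using measurable_cong_sets[OF that refl, of borel] by auto
  moreover have "(SUP i. U i) = (\<lambda>x. SUP i. U i x)" by (simp add: fun_eq_iff image_comp)
  ultimately have "nn_integral N (SUP i. U i) = (SUP i. nn_integral N (U i))" if "sets N = sets M" for N
    using that nn_integral_monotone_convergence_SUP[OF seq(3), of N] by simp
  moreover have "incseq (\<lambda>i. nn_integral N (U i))" for N
    using seq(3) by (auto simp: incseq_def le_fun_def intro!: nn_integral_mono)
  ultimately have "nn_integral N (SUP i. U i) + nn_integral N' (SUP i. U i)
      = (SUP i. nn_integral N (U i) + nn_integral N' (U i))" if "sets N = sets M" "sets N' = sets M" for N N'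
    using that by (simp add: ennreal_SUP_add)
  note this[OF sets(1,2)] this[OF sets(3,4)]
  then show ?case by (simp only: seq.IH)
qed

text \<open>
  Adding the bound \<open>B\<close> makes the integrand non-negative, and \<open>E = space M\<close> shows that this changes
  both sides by the same amount.
\<close>
lemma integral_eq_of_measure_add_eq:
  fixes f :: "'a \<Rightarrow> real"
  assumes fin: "finite_measure P" "finite_measure Q" "finite_measure R" "finite_measure S"
    and sets: "sets P = sets M" "sets Q = sets M" "sets R = sets M" "sets S = sets M"
    and eq: "\<And>E. E \<in> sets M \<Longrightarrow> measure P E + measure Q E = measure R E + measure S E"
    and f: "f \<in> borel_measurable M" and bdd: "\<And>x. x \<in> space M \<Longrightarrow> \<bar>f x\<bar> \<le> B"
  shows "integral\<^sup>L P f + integral\<^sup>L Q f = integral\<^sup>L R f + integral\<^sup>L S f"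
proof -
  let ?f = "\<lambda>x. ennreal (f x + B)"
  have N: "f \<in> borel_measurable N" "space N = space M" if "sets N = sets M" for N
    using f measurable_cong_sets[OF that refl, of borel] sets_eq_imp_space_eq[OF that] by auto
  have int: "integral\<^sup>L N f = enn2real (nn_integral N ?f) - B * measure N (space M)"
    "nn_integral N ?f < \<infinity>"
    if "sets N = sets M" "finite_measure N" for N
  proof -
    interpret finite_measure N by fact
    have i: "integrable N f"
      using N[OF that(1)] bdd by (intro integrable_const_bound[where B = B]) auto
    then have "integral\<^sup>L N (\<lambda>x. f x + B) = integral\<^sup>L N f + B * measure N (space M)"
      using N[OF that(1)] by simp
    moreover have "f x + B \<ge> 0" if "x \<in> space N" for x
      using bdd[of x] N[OF \<open>sets N = sets M\<close>] that by (auto simp: abs_le_iff)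
    then have ae: "AE x in N. 0 \<le> f x + B" by simp
    then have "integral\<^sup>L N (\<lambda>x. f x + B) = enn2real (nn_integral N ?f)"
      using i by (intro integral_eq_nn_integral) auto
    ultimately show "integral\<^sup>L N f = enn2real (nn_integral N ?f) - B * measure N (space M)" by simp
    show "nn_integral N ?f < \<infinity>"
      using i ae by (subst nn_integral_eq_integral) auto
  qed
  have "nn_integral P ?f + nn_integral Q ?f = nn_integral R ?f + nn_integral S ?f"
  proof (rule nn_integral_eq_of_emeasure_add_eq[OF sets])
    show "emeasure P E + emeasure Q E = emeasure R E + emeasure S E" if "E \<in> sets M" for E
      using eq[OF that] fin by (simp add: finite_measure.emeasure_eq_measure flip: ennreal_plus)
  qed (use f in auto)
  then have "enn2real (nn_integral P ?f) + enn2real (nn_integral Q ?f)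
      = enn2real (nn_integral R ?f) + enn2real (nn_integral S ?f)"
    using int(2) fin sets by (simp flip: enn2real_plus)
  moreover have "measure P (space M) + measure Q (space M) = measure R (space M) + measure S (space M)"
    by (rule eq) simp
  then have "B * measure P (space M) + B * measure Q (space M) = B * measure R (space M) + B * measure S (space M)"
    by (simp flip: distrib_left)
  ultimately show ?thesis using int(1) fin sets by simp
qed

lemma signed_set_integral_diff:
  fixes f :: "'a \<Rightarrow> real"
  assumes M1: "finite_measure M1" "sets M1 = sets M" and M2: "finite_measure M2" "sets M2 = sets M"
    and \<mu>: "\<And>E. E \<in> sets M \<Longrightarrow> \<mu> E = measure M1 E - measure M2 E"
    and f: "(\<lambda>x. indicator A x *\<^sub>R f x) \<in> borel_measurable M" and bdd: "\<And>x. x \<in> A \<Longrightarrow> \<bar>f x\<bar> \<le> B"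
  shows "signed_set_integral M \<mu> A f = (LINT x:A|M1. f x) - (LINT x:A|M2. f x)"
proof -
  have sp: "space M1 = space M" using M1 sets_eq_imp_space_eq by blast
  obtain Y where Y: "Y \<in> sets M"
    "\<And>X. X \<in> sets M \<Longrightarrow> X \<subseteq> Y \<Longrightarrow> emeasure M2 X \<le> emeasure M1 X"
    "\<And>X. X \<in> sets M \<Longrightarrow> X \<inter> Y = {} \<Longrightarrow> emeasure M1 X \<le> emeasure M2 X"
    using finite_unsigned_Hahn_decomposition[OF M1(1) M2(1)] M1 M2 by metis
  let ?P = "pos_variation M \<mu>" and ?Q = "pos_variation M (\<lambda>E. - \<mu> E)"
  have P: "sets ?P = sets M" "finite_measure ?P"
    by (rule pos_variation_diff[OF M1 M2]; fact \<mu> Y)+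
  have P_eq: "measure ?P E = measure M1 (E \<inter> Y) - measure M2 (E \<inter> Y)" if E: "E \<in> sets M" for E
    by (rule pos_variation_diff[OF M1 M2]; fact \<mu> Y E)
  have \<mu>': "- \<mu> E = measure M2 E - measure M1 E" if "E \<in> sets M" for E using \<mu>[OF that] by simp
  have Y': "space M - Y \<in> sets M"
    "\<And>X. X \<in> sets M \<Longrightarrow> X \<subseteq> space M - Y \<Longrightarrow> emeasure M1 X \<le> emeasure M2 X"
    "\<And>X. X \<in> sets M \<Longrightarrow> X \<inter> (space M - Y) = {} \<Longrightarrow> emeasure M2 X \<le> emeasure M1 X"
  proof -
    show "space M - Y \<in> sets M" using Y by auto
    fix X assume X: "X \<in> sets M"
    show "emeasure M1 X \<le> emeasure M2 X" if "X \<subseteq> space M - Y" using that by (intro Y(3) X) blast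
    show "emeasure M2 X \<le> emeasure M1 X" if "X \<inter> (space M - Y) = {}"
      using that sets.sets_into_space[OF X] by (intro Y(2) X) blast
  qed
  have Q: "sets ?Q = sets M" "finite_measure ?Q"
    by (rule pos_variation_diff[OF M2 M1]; fact \<mu>' Y')+
  have Q_eq: "measure ?Q E = measure M2 (E \<inter> (space M - Y)) - measure M1 (E \<inter> (space M - Y))"
    if E: "E \<in> sets M" for E
    by (rule pos_variation_diff[OF M2 M1]; fact \<mu>' Y' E)
  have split: "measure N F = measure N (F \<inter> Y) + measure N (F \<inter> (space M - Y))"
    if "finite_measure N" "sets N = sets M" "F \<in> sets M" for N F
  proof -
    have "(F \<inter> Y) \<union> (F \<inter> (space M - Y)) = F" using sets.sets_into_space[OF that(3)] by blast
    then show ?thesis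
      using finite_measure.finite_measure_Union[OF that(1), of "F \<inter> Y" "F \<inter> (space M - Y)"] that Y by auto
  qed
  have "(\<integral>x. indicator A x *\<^sub>R f x \<partial>?P) + (\<integral>x. indicator A x *\<^sub>R f x \<partial>M2)
      = (\<integral>x. indicator A x *\<^sub>R f x \<partial>M1) + (\<integral>x. indicator A x *\<^sub>R f x \<partial>?Q)"
  proof (rule integral_eq_of_measure_add_eq[where B = "max 0 B"])
    show "measure ?P E + measure M2 E = measure M1 E + measure ?Q E" if "E \<in> sets M" for E
      using P_eq[OF that] Q_eq[OF that] split[OF M1 that] split[OF M2 that] by linarith
    show "\<bar>indicator A x *\<^sub>R f x\<bar> \<le> max 0 B" for x
      using bdd[of x] by (auto simp: indicator_def)
  qed (use P Q M1 M2 f in auto)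
  then show ?thesis
    unfolding signed_set_integral_def set_lebesgue_integral_def by linarith
qed

text \<open>
  The change-of-variables formula for the image of a signed measure with density \<open>f\<close>. The images
  of the positive and negative parts of \<open>f\<close> need not be mutually singular, so they are in general
  not the Jordan decomposition of the image; integrals of bounded functions do not see the
  difference.
\<close>
lemma signed_set_integral_image:
  fixes f :: "'b \<Rightarrow> real" and g :: "'a \<Rightarrow> real"
  assumes T: "T \<in> measurable H M" and f: "integrable H f"
    and \<mu>: "\<And>E. E \<in> sets M \<Longrightarrow> \<mu> E = (\<integral>x. f x * indicator E (T x) \<partial>H)"
    and g: "(\<lambda>x. indicator A x *\<^sub>R g x) \<in> borel_measurable M" and bdd: "\<And>x. x \<in> A \<Longrightarrow> \<bar>g x\<bar> \<le> B"
  shows "signed_set_integral M \<mu> A g = (\<integral>x. f x * (indicator A (T x) * g (T x)) \<partial>H)"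
proof -
  define D where "D h = distr (density H (\<lambda>x. ennreal (max 0 (h x)))) M T" for h :: "'b \<Rightarrow> real"
  have sets_D: "sets (D h) = sets M" for h by (simp add: D_def)
  have D_int: "integral\<^sup>L (D h) k = (\<integral>x. max 0 (h x) * k (T x) \<partial>H)"
    if "integrable H h" "k \<in> borel_measurable M" for h and k :: "'a \<Rightarrow> real"
  proof -
    have [measurable]: "h \<in> borel_measurable H" using that by auto
    note [measurable] = T that(2)
    show ?thesis
      unfolding D_def by (subst integral_distr, simp, simp, subst integral_density) auto
  qed
  have fin_D: "finite_measure (D h)" if h: "integrable H h" for h
  proof (rule finite_measureI)
    have [measurable]: "h \<in> borel_measurable H" using that by auto
    have "emeasure (D h) (space (D h)) = (\<integral>\<^sup>+x. ennreal (max 0 (h x)) \<partial>H)"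
      unfolding D_def using T by (subst emeasure_distr)
        (auto simp: emeasure_density measurable_space intro!: nn_integral_cong)
    also have "\<dots> < \<infinity>" using h by (subst nn_integral_eq_integral) auto
    finally show "emeasure (D h) (space (D h)) \<noteq> \<infinity>" by simp
  qed
  have meas_D: "measure (D h) E = (\<integral>x. max 0 (h x) * indicator E (T x) \<partial>H)"
    if "integrable H h" "E \<in> sets M" for h E
  proof -
    have "measure (D h) E = (\<integral>x. indicator E x \<partial>D h)"
      using that sets_D[of h] sets.sets_into_space[of E "D h"] by (simp add: Int_absorb2)
    also have "\<dots> = (\<integral>x. max 0 (h x) * indicator E (T x) \<partial>H)"
      using that by (intro D_int) auto
    finally show ?thesis .
  qed
  have diff: "(\<integral>x. max 0 (f x) * k (T x) \<partial>H) - (\<integral>x. max 0 (- f x) * k (T x) \<partial>H) = (\<integral>x. f x * k (T x) \<partial>H)"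
    if k: "k \<in> borel_measurable M" and bk: "\<And>x. \<bar>k x\<bar> \<le> B'" for k :: "'a \<Rightarrow> real" and B'
  proof -
    note [measurable] = T k
    have i: "integrable H (\<lambda>x. max 0 (h x) * k (T x))" if h: "integrable H h" for h
    proof (rule Bochner_Integration.integrable_bound)
      show "integrable H (\<lambda>x. B' * h x)" using h by simp
      have [measurable]: "h \<in> borel_measurable H" using h by auto
      show "(\<lambda>x. max 0 (h x) * k (T x)) \<in> borel_measurable H" by measurable
      have "\<bar>max 0 y * k z\<bar> \<le> \<bar>B' * y\<bar>" for y z
      proof -
        have "\<bar>max 0 y\<bar> * \<bar>k z\<bar> \<le> \<bar>y\<bar> * \<bar>B'\<bar>"
          using bk[of z] by (intro mult_mono) auto
        then show ?thesis by (simp add: abs_mult mult.commute)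
      qed
      then show "AE x in H. norm (max 0 (h x) * k (T x)) \<le> norm (B' * h x)" by simp
    qed
    have "max 0 y * c - max 0 (- y) * c = y * c" for y c :: real by (auto simp: max_def)
    then show ?thesis
      using i[OF f] i[of "\<lambda>x. - f x"] f by (subst Bochner_Integration.integral_diff[symmetric]) auto
  qed
  have f': "integrable H (\<lambda>x. - f x)" using f by simp
  have "signed_set_integral M \<mu> A g = (LINT x:A|D f. g x) - (LINT x:A|D (\<lambda>x. - f x). g x)"
  proof (rule signed_set_integral_diff[OF fin_D sets_D fin_D sets_D _ g bdd])
    fix E assume E: "E \<in> sets M"
    show "\<mu> E = measure (D f) E - measure (D (\<lambda>x. - f x)) E"
      unfolding \<mu>[OF E] meas_D[OF f E] meas_D[OF f' E]
      by (rule diff[symmetric, where B' = 1]) (use E in \<open>auto simp: indicator_def\<close>)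
  qed (use f f' in auto)
  also have "\<dots> = (\<integral>x. f x * (indicator A (T x) *\<^sub>R g (T x)) \<partial>H)"
    unfolding set_lebesgue_integral_def D_int[OF f g] D_int[OF f' g]
  proof (rule diff[OF g])
    show "\<bar>indicator A x *\<^sub>R g x\<bar> \<le> max 0 B" for x
      using bdd[of x] by (auto simp: indicator_def)
  qed
  finally show ?thesis by simp
qed

section \<open>Derivatives that are uniform over a compact set\<close>

lemma C1_increment:
  fixes f f' :: "real \<Rightarrow> real"
  assumes "\<And>x. \<bar>x - y\<bar> \<le> \<bar>s\<bar> \<Longrightarrow> (f has_field_derivative f' x) (at x)"
  obtains \<xi> where "\<bar>\<xi> - y\<bar> \<le> \<bar>s\<bar>" "f (y + s) - f y = s * f' \<xi>"
proof (cases s "0 :: real" rule: linorder_cases)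
  case less
  then obtain z where "y + s < z" "z < y" "f y - f (y + s) = (y - (y + s)) * f' z"
    using MVT2[of "y + s" y f f'] assms by (auto simp: abs_if)
  then show ?thesis using less by (intro that[of z]) (auto simp: algebra_simps)
next
  case greater
  then obtain z where "y < z" "z < y + s" "f (y + s) - f y = (y + s - y) * f' z"
    using MVT2[of y "y + s" f f'] assms by (auto simp: abs_if)
  then show ?thesis using greater by (intro that[of z]) (auto simp: algebra_simps)
qed (use that[of y] in auto)

lemma bounded_on_compact:
  fixes d :: "'a::topological_space \<Rightarrow> real"
  assumes "compact \<Omega>" "continuous_on \<Omega> d"
  obtains B where "B > 0" "\<And>v. v \<in> \<Omega> \<Longrightarrow> \<bar>d v\<bar> \<le> B"
  using compact_imp_bounded[OF compact_continuous_image[OF assms(2,1)]] that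
  by (auto simp: bounded_pos)

text \<open>
  The mean value theorem replaces the difference quotient by \<open>g v * f' \<xi>\<close>. All the \<open>\<xi>\<close> lie in one
  compact neighbourhood \<open>D\<close> of the range of \<open>y\<close>, on which \<open>f'\<close> is uniformly continuous.
\<close>
lemma uniform_limit_difference_quotient:
  fixes f f' :: "real \<Rightarrow> real" and y g :: "'a::topological_space \<Rightarrow> real"
  assumes J: "open J" and f: "\<And>x. x \<in> J \<Longrightarrow> (f has_field_derivative f' x) (at x)" and f': "continuous_on J f'"
    and \<Omega>: "compact \<Omega>" and y: "continuous_on \<Omega> y" "y ` \<Omega> \<subseteq> J" and g: "continuous_on \<Omega> g"
  shows "\<forall>\<^sub>F \<epsilon> in at 0. \<forall>v\<in>\<Omega>. y v + \<epsilon> * g v \<in> J"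
    and "uniform_limit \<Omega> (\<lambda>\<epsilon> v. (f (y v + \<epsilon> * g v) - f (y v)) / \<epsilon>) (\<lambda>v. g v * f' (y v)) (at 0)"
proof -
  have C: "compact (y ` \<Omega>)" using y(1) \<Omega> by (rule compact_continuous_image)
  obtain \<eta> where \<eta>: "\<eta> > 0" "(\<Union>x\<in>y ` \<Omega>. cball x \<eta>) \<subseteq> J"
    using compact_subset_open_imp_cball_epsilon_subset[OF C J y(2)] by auto
  obtain B where B: "B > 0" "\<And>v. v \<in> \<Omega> \<Longrightarrow> \<bar>g v\<bar> \<le> B" using bounded_on_compact[OF \<Omega> g] by blast
  have small: "\<forall>\<^sub>F \<epsilon> in at 0. \<epsilon> \<noteq> 0 \<and> (\<forall>v\<in>\<Omega>. \<bar>\<epsilon> * g v\<bar> < \<delta>)" if "\<delta> > 0" for \<delta>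
  proof -
    have "\<forall>\<^sub>F \<epsilon> in at 0. dist \<epsilon> 0 < \<delta> / B \<and> \<epsilon> \<noteq> 0"
      unfolding eventually_at using that B(1) by (intro exI[of _ "\<delta> / B"]) auto
    then show ?thesis
    proof eventually_elim
      case (elim \<epsilon>)
      have "\<bar>\<epsilon> * g v\<bar> < \<delta>" if "v \<in> \<Omega>" for v
      proof -
        have "\<bar>\<epsilon> * g v\<bar> \<le> \<bar>\<epsilon>\<bar> * B" unfolding abs_mult using B(2)[OF that] by (intro mult_left_mono) auto
        also have "\<dots> < \<delta>" using elim B(1) by (simp add: field_simps)
        finally show ?thesis .
      qed
      then show ?case using elim by blast
    qed
  qed
  have inJ: "x \<in> J" if "v \<in> \<Omega>" "\<bar>x - y v\<bar> \<le> \<eta>" for x v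
  proof -
    have "x \<in> cball (y v) \<eta>" using that(2) by (simp add: dist_real_def abs_minus_commute)
    then show ?thesis using \<eta>(2) that(1) by blast
  qed
  show "\<forall>\<^sub>F \<epsilon> in at 0. \<forall>v\<in>\<Omega>. y v + \<epsilon> * g v \<in> J"
    using small[OF \<eta>(1)] by eventually_elim (force intro!: inJ)
  define D where "D = {a + b | a b. a \<in> y ` \<Omega> \<and> b \<in> cball 0 \<eta>}"
  have "compact D" unfolding D_def using C by (intro compact_sums) auto
  moreover have DJ: "D \<subseteq> J" using inJ by (auto simp: D_def)
  ultimately have uc: "uniformly_continuous_on D f'"
    using f' continuous_on_subset by (intro compact_uniformly_continuous) auto
  show "uniform_limit \<Omega> (\<lambda>\<epsilon> v. (f (y v + \<epsilon> * g v) - f (y v)) / \<epsilon>) (\<lambda>v. g v * f' (y v)) (at 0)"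
  proof (rule uniform_limitI)
    fix e :: real assume "e > 0"
    then have "e / B > 0" using B by simp
    then obtain \<delta> where \<delta>: "\<delta> > 0" "\<And>x x'. x \<in> D \<Longrightarrow> x' \<in> D \<Longrightarrow> dist x' x < \<delta> \<Longrightarrow> dist (f' x') (f' x) < e / B"
      using uc unfolding uniformly_continuous_on_def by metis
    have "min \<eta> \<delta> > 0" using \<eta> \<delta> by simp
    from small[OF this]
    show "\<forall>\<^sub>F \<epsilon> in at 0. \<forall>v\<in>\<Omega>. dist ((f (y v + \<epsilon> * g v) - f (y v)) / \<epsilon>) (g v * f' (y v)) < e"
    proof eventually_elim
      case (elim \<epsilon>)
      show ?case
      proof
        fix v assume v: "v \<in> \<Omega>"
        have s: "\<bar>\<epsilon> * g v\<bar> < \<eta>" "\<bar>\<epsilon> * g v\<bar> < \<delta>" using elim v by auto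
        obtain \<xi> where \<xi>: "\<bar>\<xi> - y v\<bar> \<le> \<bar>\<epsilon> * g v\<bar>" "f (y v + \<epsilon> * g v) - f (y v) = \<epsilon> * g v * f' \<xi>"
          using C1_increment[of "y v" "\<epsilon> * g v" f f'] f inJ[OF v] s by (metis less_imp_le order_trans)
        have "\<xi> = y v + (\<xi> - y v)" "y v = y v + 0" by auto
        moreover have "\<xi> - y v \<in> cball 0 \<eta>" "0 \<in> cball 0 \<eta>" using \<xi>(1) s \<eta> by auto
        ultimately have "\<xi> \<in> D" "y v \<in> D" unfolding D_def using v by blast+
        then have "\<bar>f' \<xi> - f' (y v)\<bar> < e / B"
          using \<delta>(2)[of "y v" \<xi>] \<xi>(1) s by (auto simp: dist_real_def)
        then have "B * \<bar>f' \<xi> - f' (y v)\<bar> < e" using B(1) by (simp add: field_simps)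
        moreover have "\<bar>g v\<bar> * \<bar>f' \<xi> - f' (y v)\<bar> \<le> B * \<bar>f' \<xi> - f' (y v)\<bar>"
          using B(2)[OF v] by (intro mult_right_mono) auto
        moreover have "(f (y v + \<epsilon> * g v) - f (y v)) / \<epsilon> - g v * f' (y v) = g v * (f' \<xi> - f' (y v))"
          using elim by (simp add: \<xi>(2) algebra_simps)
        ultimately show "dist ((f (y v + \<epsilon> * g v) - f (y v)) / \<epsilon>) (g v * f' (y v)) < e"
          by (simp add: dist_real_def abs_mult)
      qed
    qed
  qed
qed

text \<open>
  The reciprocal of the perturbation is the C1 function \<open>1 / \<theta>\<close>, with \<open>\<theta>\<close> the inverse of \<open>\<phi>\<close>,
  evaluated along the lines \<open>\<phi> (h v) + \<epsilon> g v\<close>. By invariance of domain the range of \<open>\<phi>\<close> is open,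
  so for small \<open>\<epsilon>\<close> these lines stay in it for all \<open>v\<close> at once. Reciprocals are used because the
  gauge of an Aleksandrov body is linear in \<open>1 / h\<close> for each fixed \<open>v\<close>.
\<close>
lemma orlicz_perturbation_reciprocal:
  fixes g h :: "'a::topological_space \<Rightarrow> real"
  assumes \<Omega>: "compact \<Omega>" and g: "continuous_on \<Omega> g"
    and h: "continuous_on \<Omega> h" "\<And>v. v \<in> \<Omega> \<Longrightarrow> h v > 0"
    and \<phi>: "inj_on \<phi> {0<..}" "\<phi> C1_differentiable_on {0<..}" "\<And>t. t > 0 \<Longrightarrow> deriv \<phi> t \<noteq> 0"
  shows "\<And>v. v \<in> \<Omega> \<Longrightarrow> orlicz_perturbation \<phi> h g 0 v = h v"
    and "\<forall>\<^sub>F \<epsilon> in at 0. continuous_on \<Omega> (orlicz_perturbation \<phi> h g \<epsilon>) \<and>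
      (\<forall>v\<in>\<Omega>. orlicz_perturbation \<phi> h g \<epsilon> v > 0)"
    and "uniform_limit \<Omega> (\<lambda>\<epsilon> v. (1 / orlicz_perturbation \<phi> h g \<epsilon> v - 1 / h v) / \<epsilon>)
      (\<lambda>v. - g v / ((h v)\<^sup>2 * deriv \<phi> (h v))) (at 0)"
    and "continuous_on {0<..} (deriv \<phi>)"
proof -
  define \<theta> where "\<theta> = inv_into {0<..} \<phi>"
  define J where "J = \<phi> ` {0<..}"
  obtain D where D: "\<And>t. t > 0 \<Longrightarrow> (\<phi> has_field_derivative D t) (at t)" "continuous_on {0<..} D"
    using \<phi>(2) unfolding C1_differentiable_on_def has_real_derivative_iff_has_vector_derivative by auto
  have deriv_D: "deriv \<phi> t = D t" if "t > 0" for t using D(1)[OF that] by (rule DERIV_imp_deriv)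
  have der: "(\<phi> has_field_derivative deriv \<phi> t) (at t)" if "t > 0" for t
    using D(1)[OF that] deriv_D[OF that] by simp
  show cd: "continuous_on {0<..} (deriv \<phi>)"
    using D(2) by (rule continuous_on_eq) (simp add: deriv_D)
  have cont: "continuous_on {0<..} \<phi>"
    using der by (intro continuous_at_imp_continuous_on) (auto intro: DERIV_isCont)
  have J: "open J" unfolding J_def using cont \<phi>(1) by (intro invariance_of_domain) auto
  have \<theta>_cont: "continuous_on J \<theta>"
    unfolding J_def \<theta>_def using cont \<phi>(1) by (intro continuous_on_inverse_open) auto
  have \<theta>: "\<phi> (\<theta> x) = x" "\<theta> x > 0" if "x \<in> J" for x
    using that inv_into_into[of x \<phi> "{0<..}"] by (auto simp: J_def \<theta>_def f_inv_into_f)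
  have \<theta>': "(\<theta> has_field_derivative inverse (deriv \<phi> (\<theta> x))) (at x)" if x: "x \<in> J" for x
  proof -
    obtain e where e: "e > 0" "ball x e \<subseteq> J" using J x openE by blast
    show ?thesis
    proof (rule DERIV_inverse_function[where a = "x - e" and b = "x + e"])
      show "(\<phi> has_field_derivative deriv \<phi> (\<theta> x)) (at (\<theta> x))" using der \<theta> x by simp
      show "\<phi> (\<theta> z) = z" if "x - e < z" "z < x + e" for z
        using e that by (intro \<theta>) (auto simp: dist_real_def subset_iff)
      show "isCont \<theta> x" using \<theta>_cont J x by (simp add: continuous_on_eq_continuous_at)
    qed (use \<phi>(3) \<theta> x e in auto)
  qed
  define f' where "f' x = - (inverse (deriv \<phi> (\<theta> x))) / (\<theta> x)\<^sup>2" for x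
  have f: "((\<lambda>x. 1 / \<theta> x) has_field_derivative f' x) (at x)" if x: "x \<in> J" for x
    using \<theta>(2)[OF x] unfolding f'_def
    by (auto intro!: derivative_eq_intros \<theta>'[OF x] simp: power2_eq_square)
  have f'_cont: "continuous_on J f'"
    unfolding f'_def using \<theta> \<phi>(3)
    by (intro continuous_intros \<theta>_cont continuous_on_compose2[OF cd \<theta>_cont]) force+
  define y where "y v = \<phi> (h v)" for v
  have y: "continuous_on \<Omega> y" unfolding y_def using h by (intro continuous_on_compose2[OF cont h(1)]) auto
  have yJ: "y ` \<Omega> \<subseteq> J" using h by (auto simp: y_def J_def)
  have \<theta>y: "\<theta> (y v) = h v" if "v \<in> \<Omega>" for v
    unfolding \<theta>_def y_def using h(2)[OF that] \<phi>(1) by (intro inv_into_f_f) auto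
  have pert: "orlicz_perturbation \<phi> h g \<epsilon> v = \<theta> (y v + \<epsilon> * g v)" for \<epsilon> v
    by (simp add: orlicz_perturbation_def \<theta>_def y_def)
  show "orlicz_perturbation \<phi> h g 0 v = h v" if "v \<in> \<Omega>" for v using \<theta>y[OF that] by (simp add: pert)
  have lim: "\<forall>\<^sub>F \<epsilon> in at 0. \<forall>v\<in>\<Omega>. y v + \<epsilon> * g v \<in> J"
    "uniform_limit \<Omega> (\<lambda>\<epsilon> v. (1 / \<theta> (y v + \<epsilon> * g v) - 1 / \<theta> (y v)) / \<epsilon>) (\<lambda>v. g v * f' (y v)) (at 0)"
    by (rule uniform_limit_difference_quotient; fact J f f'_cont \<Omega> y yJ g)+
  from lim(1)
  show "\<forall>\<^sub>F \<epsilon> in at 0. continuous_on \<Omega> (orlicz_perturbation \<phi> h g \<epsilon>) \<and>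
      (\<forall>v\<in>\<Omega>. orlicz_perturbation \<phi> h g \<epsilon> v > 0)"
  proof eventually_elim
    case (elim \<epsilon>)
    then show ?case unfolding pert using \<theta>
      by (auto intro!: continuous_on_compose2[OF \<theta>_cont] continuous_intros y g)
  qed
  show "uniform_limit \<Omega> (\<lambda>\<epsilon> v. (1 / orlicz_perturbation \<phi> h g \<epsilon> v - 1 / h v) / \<epsilon>)
      (\<lambda>v. - g v / ((h v)\<^sup>2 * deriv \<phi> (h v))) (at 0)"
    using lim(2)
    by (rule uniform_limit_cong'[THEN iffD1, rotated 2]) (auto simp: pert \<theta>y f'_def divide_simps)
qed

text \<open>
  With \<open>Q\<close> the difference quotient at a single point, comparing the two maxima at \<open>v0\<close> and at a
  maximiser \<open>v1\<close> of \<open>w \<epsilon>\<close> squeezes the difference quotient of the maxima between \<open>Q v0\<close> and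
  \<open>Q v1\<close>. Both are near \<open>d v0\<close>, because \<open>v1\<close> is forced to be near \<open>v0\<close>: away from \<open>v0\<close> compactness
  gives a gap \<open>c\<close> below the maximum of \<open>w0\<close>, which a small perturbation cannot close.
\<close>
lemma danskin:
  fixes w :: "real \<Rightarrow> 'a::metric_space \<Rightarrow> real"
  assumes \<Omega>: "compact \<Omega>" and w0: "continuous_on \<Omega> w0"
    and w: "\<forall>\<^sub>F \<epsilon> in at 0. continuous_on \<Omega> (w \<epsilon>)"
    and lim: "uniform_limit \<Omega> (\<lambda>\<epsilon> v. (w \<epsilon> v - w0 v) / \<epsilon>) d (at 0)" and d: "continuous_on \<Omega> d"
    and v0: "v0 \<in> \<Omega>" and max: "\<And>v. v \<in> \<Omega> \<Longrightarrow> v \<noteq> v0 \<Longrightarrow> w0 v < w0 v0"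
  shows "((\<lambda>\<epsilon>. ((SUP v\<in>\<Omega>. w \<epsilon> v) - (SUP v\<in>\<Omega>. w0 v)) / \<epsilon>) \<longlongrightarrow> d v0) (at 0)"
proof (rule tendstoI)
  fix e :: real assume e: "e > 0"
  obtain D where D: "D > 0" "\<And>v. v \<in> \<Omega> \<Longrightarrow> \<bar>d v\<bar> \<le> D" using bounded_on_compact[OF \<Omega> d] by blast
  obtain r where r: "r > 0" "\<And>v. v \<in> \<Omega> \<Longrightarrow> dist v v0 < r \<Longrightarrow> \<bar>d v - d v0\<bar> < e / 2"
    using d v0 e unfolding continuous_on_iff dist_real_def by (metis half_gt_zero)
  obtain c where c: "c > 0" "\<And>v. v \<in> \<Omega> \<Longrightarrow> \<not> dist v v0 < r \<Longrightarrow> w0 v \<le> w0 v0 - c"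
  proof (cases "\<Omega> - ball v0 r = {}")
    case True
    then show ?thesis by (intro that[of 1]) (auto simp: dist_commute subset_iff)
  next
    case False
    have "compact (\<Omega> - ball v0 r)" using \<Omega> by (intro compact_diff) auto
    then obtain v1 where v1: "v1 \<in> \<Omega> - ball v0 r" "\<forall>v\<in>\<Omega> - ball v0 r. w0 v \<le> w0 v1"
      using continuous_attains_sup[OF _ False continuous_on_subset[OF w0]] by blast
    have "v1 \<noteq> v0" using v1 r by auto
    then have "w0 v1 < w0 v0" using max v1 by blast
    then show ?thesis using that[of "w0 v0 - w0 v1"] v1 by (auto simp: dist_commute)
  qed
  have M0: "(SUP v\<in>\<Omega>. w0 v) = w0 v0"
    using v0 max by (intro cSup_eq_maximum) (auto intro: less_imp_le)
  have "min (e / 2) 1 > 0" using e by simp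
  note ev1 = uniform_limitD[OF lim this]
  have ev2: "\<forall>\<^sub>F \<epsilon> in at 0. dist \<epsilon> 0 < c / (2 * (D + 1)) \<and> \<epsilon> \<noteq> 0"
    unfolding eventually_at using c D by (intro exI[of _ "c / (2 * (D + 1))"]) auto
  from w ev1 ev2
  show "\<forall>\<^sub>F \<epsilon> in at 0. dist (((SUP v\<in>\<Omega>. w \<epsilon> v) - (SUP v\<in>\<Omega>. w0 v)) / \<epsilon>) (d v0) < e"
  proof eventually_elim
    case (elim \<epsilon>)
    define Q where "Q v = (w \<epsilon> v - w0 v) / \<epsilon>" for v
    have \<epsilon>0: "\<epsilon> \<noteq> 0" and \<epsilon>c: "2 * ((D + 1) * \<bar>\<epsilon>\<bar>) < c" using elim D by (auto simp: field_simps)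
    have Q: "\<bar>Q v - d v\<bar> < e / 2" "\<bar>Q v - d v\<bar> < 1" if "v \<in> \<Omega>" for v
      using elim(2) that by (auto simp: Q_def dist_real_def)
    have wQ: "w \<epsilon> v = w0 v + \<epsilon> * Q v" for v using \<epsilon>0 by (simp add: Q_def)
    have diff: "\<bar>\<epsilon> * Q v\<bar> \<le> (D + 1) * \<bar>\<epsilon>\<bar>" if "v \<in> \<Omega>" for v
    proof -
      have "\<bar>Q v\<bar> \<le> D + 1" using Q(2)[OF that] D(2)[OF that] by linarith
      then have "\<bar>\<epsilon>\<bar> * \<bar>Q v\<bar> \<le> \<bar>\<epsilon>\<bar> * (D + 1)" by (intro mult_left_mono) auto
      then show ?thesis by (simp add: abs_mult mult.commute)
    qed
    obtain v1 where v1: "v1 \<in> \<Omega>" "\<forall>v\<in>\<Omega>. w \<epsilon> v \<le> w \<epsilon> v1"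
      using continuous_attains_sup[OF \<Omega> _ elim(1)] v0 by blast
    have M: "(SUP v\<in>\<Omega>. w \<epsilon> v) = w \<epsilon> v1" using v1 by (intro cSup_eq_maximum) auto
    have "w \<epsilon> v0 \<le> w \<epsilon> v1" using v1 v0 by blast
    then have lower: "\<epsilon> * Q v0 \<le> w \<epsilon> v1 - w0 v0" by (simp add: wQ)
    have "dist v1 v0 < r"
    proof (rule ccontr)
      assume "\<not> ?thesis"
      then have "w0 v1 \<le> w0 v0 - c" using c v1 by blast
      then show False using lower diff[OF v0] diff[OF v1(1)] \<epsilon>c wQ[of v1] by linarith
    qed
    then have "\<bar>d v1 - d v0\<bar> < e / 2" using r v1 by blast
    then have Q1: "\<bar>Q v1 - d v0\<bar> < e" using Q(1)[OF v1(1)] by linarith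
    have Q0: "\<bar>Q v0 - d v0\<bar> < e" using Q(1)[OF v0] e by linarith
    have "w0 v1 \<le> w0 v0" using max[OF v1(1)] by (cases "v1 = v0") auto
    then have upper: "w \<epsilon> v1 - w0 v0 \<le> \<epsilon> * Q v1" by (simp add: wQ)
    define q where "q = (w \<epsilon> v1 - w0 v0) / \<epsilon>"
    have "(Q v0 \<le> q \<and> q \<le> Q v1) \<or> (Q v1 \<le> q \<and> q \<le> Q v0)"
      using lower upper \<epsilon>0 by (cases "\<epsilon> > 0") (auto simp: q_def field_simps)
    then have "\<bar>q - d v0\<bar> < e" using Q0 Q1 by linarith
    then show ?case by (simp add: q_def M M0 dist_real_def)
  qed
qed

section \<open>The gauge of an Aleksandrov body\<close>

text \<open>
  This is the gauge (Minkowski functional) of the Aleksandrov body of \<open>h\<close>, written as a maximum of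
  linear functions.
\<close>
definition max_slope :: "'a::euclidean_space set \<Rightarrow> ('a \<Rightarrow> real) \<Rightarrow> 'a \<Rightarrow> real" where
  "max_slope \<Omega> h x = (SUP v\<in>\<Omega>. (x \<bullet> v) / h v)"

lemma max_slope_cong: "(\<And>v. v \<in> \<Omega> \<Longrightarrow> h v = h' v) \<Longrightarrow> max_slope \<Omega> h = max_slope \<Omega> h'"
  by (simp add: max_slope_def fun_eq_iff cong: SUP_cong)

locale positive_data =
  fixes \<Omega> :: "'a::euclidean_space set" and h :: "'a \<Rightarrow> real"
  assumes closed_\<Omega>: "closed \<Omega>" and \<Omega>_sphere: "\<Omega> \<subseteq> sphere 0 1"
    and no_hemisphere: "\<not> (\<exists>v\<in>sphere 0 1. \<Omega> \<subseteq> closed_hemisphere v)"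
    and cont_h: "continuous_on \<Omega> h" and h_pos: "\<And>v. v \<in> \<Omega> \<Longrightarrow> h v > 0"
begin

abbreviation "P \<equiv> max_slope \<Omega> h"
abbreviation "K \<equiv> aleksandrov_body \<Omega> h"

lemma compact_\<Omega>: "compact \<Omega>"
  using closed_\<Omega> \<Omega>_sphere by (meson bounded_sphere bounded_subset compact_eq_bounded_closed)

lemma norm_\<Omega>: "v \<in> \<Omega> \<Longrightarrow> norm v = 1"
  using \<Omega>_sphere by auto

lemma positive_direction:
  assumes "x \<noteq> 0"
  obtains v where "v \<in> \<Omega>" "x \<bullet> v > 0"
proof -
  have "- (x /\<^sub>R norm x) \<in> sphere 0 1" using assms by simp
  then have "\<not> \<Omega> \<subseteq> closed_hemisphere (- (x /\<^sub>R norm x))" using no_hemisphere by blast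
  then obtain v where v: "v \<in> \<Omega>" "\<not> v \<bullet> (- (x /\<^sub>R norm x)) \<ge> 0"
    using \<Omega>_sphere by (auto simp: closed_hemisphere_def)
  then have "x \<bullet> v > 0"
    using assms by (auto simp: inner_commute not_le zero_less_mult_iff)
  with v show ?thesis by (intro that)
qed

lemma \<Omega>_nonempty: "\<Omega> \<noteq> {}"
proof -
  obtain b :: 'a where "b \<in> Basis" using nonempty_Basis by blast
  then have "b \<noteq> 0" by (rule nonzero_Basis)
  then obtain v where "v \<in> \<Omega>" by (rule positive_direction)
  then show ?thesis by blast
qed

lemma max_slope_attained: "\<exists>v\<in>\<Omega>. P x = (x \<bullet> v) / h v \<and> (\<forall>w\<in>\<Omega>. (x \<bullet> w) / h w \<le> P x)"
proof -
  have "continuous_on \<Omega> (\<lambda>v. (x \<bullet> v) / h v)"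
    using h_pos by (intro continuous_intros cont_h) force
  then obtain v where v: "v \<in> \<Omega>" "\<forall>w\<in>\<Omega>. (x \<bullet> w) / h w \<le> (x \<bullet> v) / h v"
    using continuous_attains_sup[OF compact_\<Omega> \<Omega>_nonempty] by blast
  then have "P x = (x \<bullet> v) / h v"
    unfolding max_slope_def by (intro cSup_eq_maximum) auto
  with v show ?thesis by (intro bexI[of _ v]) auto
qed

lemma slope_le_max_slope: "v \<in> \<Omega> \<Longrightarrow> (x \<bullet> v) / h v \<le> P x"
  using max_slope_attained[of x] by blast

lemma max_slope_le_iff: "P x \<le> c \<longleftrightarrow> (\<forall>v\<in>\<Omega>. (x \<bullet> v) / h v \<le> c)"
  using max_slope_attained[of x] by (metis order_trans)

lemma body_eq: "K = {x. P x \<le> 1}"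
  using h_pos by (auto simp: aleksandrov_body_def max_slope_le_iff)

lemma max_slope_pos: "x \<noteq> 0 \<Longrightarrow> P x > 0"
  by (metis divide_pos_pos h_pos positive_direction slope_le_max_slope less_le_trans)

lemma max_slope_zero [simp]: "P 0 = 0"
  using max_slope_attained[of 0] by auto

lemma max_slope_scaleR:
  assumes "c \<ge> 0"
  shows "P (c *\<^sub>R x) = c * P x"
proof -
  obtain v where v: "v \<in> \<Omega>" "P x = (x \<bullet> v) / h v" "\<forall>w\<in>\<Omega>. (x \<bullet> w) / h w \<le> P x"
    using max_slope_attained by blast
  have "P (c *\<^sub>R x) \<le> c * P x"
    unfolding max_slope_le_iff[of "c *\<^sub>R x"] using v(3) assms
    by (auto simp: times_divide_eq_right[symmetric] simp del: times_divide_eq_right intro: mult_left_mono)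
  moreover have "c * P x \<le> P (c *\<^sub>R x)"
    using slope_le_max_slope[OF v(1), of "c *\<^sub>R x"] v(2) by simp
  ultimately show ?thesis by simp
qed

definition "hmin = (INF v\<in>\<Omega>. h v)"

lemma hmin: "hmin > 0" "v \<in> \<Omega> \<Longrightarrow> hmin \<le> h v"
proof -
  obtain v where v: "v \<in> \<Omega>" "\<forall>w\<in>\<Omega>. h v \<le> h w"
    using continuous_attains_inf[OF compact_\<Omega> \<Omega>_nonempty cont_h] by blast
  then have "hmin = h v" unfolding hmin_def by (intro cInf_eq_minimum) auto
  then show "hmin > 0" "w \<in> \<Omega> \<Longrightarrow> hmin \<le> h w" for w using v h_pos by auto
qed

lemma abs_slope_le:
  assumes "v \<in> \<Omega>"
  shows "\<bar>(x \<bullet> v) / h v\<bar> \<le> norm x / hmin"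
proof -
  have "\<bar>x \<bullet> v\<bar> \<le> norm x" using Cauchy_Schwarz_ineq2[of x v] norm_\<Omega>[OF assms] by simp
  then show ?thesis using hmin assms h_pos[OF assms] by (auto simp: abs_divide intro!: frac_le)
qed

lemma max_slope_lipschitz: "\<bar>P x - P y\<bar> \<le> norm (x - y) / hmin"
proof -
  have "P x \<le> P y + norm (x - y) / hmin" for x y
    unfolding max_slope_le_iff[of x]
  proof
    fix v assume v: "v \<in> \<Omega>"
    have "(x \<bullet> v) / h v = (y \<bullet> v) / h v + ((x - y) \<bullet> v) / h v"
      by (simp add: inner_diff_left diff_divide_distrib)
    then show "(x \<bullet> v) / h v \<le> P y + norm (x - y) / hmin"
      using slope_le_max_slope[OF v, of y] abs_slope_le[OF v, of "x - y"] by linarith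
  qed
  from this[of x y] this[of y x] show ?thesis by (simp add: norm_minus_commute abs_le_iff)
qed

lemma continuous_on_max_slope: "continuous_on S P"
proof (rule continuous_on_subset[OF _ subset_UNIV])
  have "(1 / hmin)-lipschitz_on UNIV P"
    using max_slope_lipschitz hmin(1) by (intro lipschitz_onI) (auto simp: dist_norm dist_real_def)
  then show "continuous_on UNIV P" by (rule lipschitz_on_continuous_on)
qed

lemma max_slope_le_norm: "P x \<le> norm x / hmin"
  using max_slope_lipschitz[of x 0] by simp

lemma cball_subset_body: "cball 0 hmin \<subseteq> K"
proof
  fix x :: 'a assume "x \<in> cball 0 hmin"
  then have "norm x / hmin \<le> 1" using hmin(1) by simp
  then show "x \<in> K" unfolding body_eq using max_slope_le_norm[of x] by simp
qed

lemma max_slope_sphere_bounds: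
  obtains m M where "0 < m" "\<And>u. u \<in> sphere 0 1 \<Longrightarrow> m \<le> P u \<and> P u \<le> M"
proof -
  have "compact (sphere 0 1 :: 'a set)" "sphere 0 1 \<noteq> ({} :: 'a set)" by auto
  then obtain u where u: "u \<in> sphere 0 1" "\<forall>w\<in>sphere 0 1. P u \<le> P w"
    using continuous_attains_inf[OF _ _ continuous_on_max_slope] by blast
  show ?thesis
  proof (rule that)
    have "u \<noteq> 0" using u(1) by auto
    then show "0 < P u" by (rule max_slope_pos)
    show "P u \<le> P w \<and> P w \<le> 1 / hmin" if "w \<in> sphere 0 1" for w
      using u that max_slope_le_norm[of w] by auto
  qed
qed

lemma convex_body: "convex K"
  unfolding aleksandrov_body_def
  by (intro convex_INT) (auto simp: inner_commute convex_halfspace_le)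

lemma closed_body: "closed K"
  unfolding aleksandrov_body_def
  by (intro closed_INT) (auto simp: inner_commute closed_halfspace_le)

lemma bounded_body: "bounded K"
proof -
  obtain m M where m: "0 < m" "\<And>u. u \<in> sphere 0 1 \<Longrightarrow> m \<le> P u \<and> P u \<le> M"
    using max_slope_sphere_bounds by blast
  have "norm x \<le> 1 / m" if "x \<in> K" for x
  proof (cases "x = 0")
    case False
    have "m * norm x \<le> norm x * P (x /\<^sub>R norm x)"
      using m(2)[of "x /\<^sub>R norm x"] False by (simp add: mult.commute)
    also have "\<dots> = P x" using False by (simp add: max_slope_scaleR)
    also have "\<dots> \<le> 1" using that by (simp add: body_eq)
    finally show ?thesis using m(1) by (simp add: field_simps)
  qed (use m in simp)
  then show ?thesis by (rule boundedI)
qed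

lemma radial_fun_body:
  assumes "u \<noteq> 0"
  shows "radial_fun K u = 1 / P u"
proof -
  have p: "P u > 0" using assms by (rule max_slope_pos)
  have "{l. l > 0 \<and> l *\<^sub>R u \<in> K} = {0 <.. 1 / P u}"
    using p by (auto simp: body_eq max_slope_scaleR field_simps)
  then show ?thesis using p unfolding radial_fun_def by (simp add: cSup_greaterThanAtMost)
qed

lemma
  assumes "norm u = 1"
  shows max_slope_pos_unit: "P u > 0" and radial_fun_body_unit: "radial_fun K u = 1 / P u"
proof -
  have "u \<noteq> 0" using assms by auto
  then show "P u > 0" "radial_fun K u = 1 / P u" by (rule max_slope_pos, rule radial_fun_body)
qed

text \<open>
  If \<open>x\<close> is interior then so is a slightly longer multiple, on which the gauge is larger.
\<close>
lemma frontier_body: "frontier K = {x. P x = 1}"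
proof -
  have "open {x. P x < 1}"
    using continuous_on_max_slope by (intro open_Collect_less) auto
  then have "{x. P x < 1} \<subseteq> interior K" by (intro interior_maximal) (auto simp: body_eq)
  moreover have "P x < 1" if x: "x \<in> interior K" for x
  proof -
    obtain e where e: "e > 0" "cball x e \<subseteq> K" using x mem_interior_cball by blast
    show ?thesis
    proof (cases "x = 0")
      case False
      define c where "c = e / norm x"
      have c: "c > 0" using e False by (simp add: c_def)
      have "x + c *\<^sub>R x \<in> cball x e" using e False by (simp add: c_def dist_norm)
      then have "P ((1 + c) *\<^sub>R x) \<le> 1" using e(2) by (auto simp: body_eq scaleR_left_distrib)
      then have "(1 + c) * P x \<le> 1" using c by (simp only: max_slope_scaleR)
      moreover have "c * P x > 0" using c max_slope_pos[OF False] by simp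
      ultimately show ?thesis by (simp add: distrib_right)
    qed simp
  qed
  ultimately have int: "interior K = {x. P x < 1}" by blast
  show ?thesis
    unfolding frontier_def int closure_closed[OF closed_body] by (auto simp: body_eq)
qed

lemma support_plane_iff:
  assumes "x \<in> K"
  shows "x \<in> support_plane K v \<longleftrightarrow> (\<forall>z\<in>K. z \<bullet> v \<le> x \<bullet> v)"
proof -
  have bdd: "bdd_above ((\<lambda>x. v \<bullet> x) ` K)"
    by (intro bounded_imp_bdd_above bounded_linear_image[OF bounded_body] bounded_linear_inner_right)
  show ?thesis
  proof
    assume "x \<in> support_plane K v"
    then have "x \<bullet> v = (SUP z\<in>K. v \<bullet> z)" by (simp add: support_plane_def support_fun_def)
    then show "\<forall>z\<in>K. z \<bullet> v \<le> x \<bullet> v"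
      using cSUP_upper[OF _ bdd] by (auto simp: inner_commute)
  next
    assume "\<forall>z\<in>K. z \<bullet> v \<le> x \<bullet> v"
    then have "(SUP z\<in>K. v \<bullet> z) = v \<bullet> x"
      using assms by (intro cSup_eq_maximum) (auto simp: inner_commute)
    then show "x \<in> support_plane K v" by (simp add: support_plane_def support_fun_def inner_commute)
  qed
qed

text \<open>
  \<open>v\<close> is an outer unit normal of \<open>K\<close> at its boundary point in direction \<open>u\<close>, namely \<open>u / P u\<close>. The
  inequality is multiplied by \<open>P u\<close>, which makes the relation closed in \<open>(u, v)\<close> everywhere.
\<close>
definition normal_at :: "'a \<Rightarrow> 'a \<Rightarrow> bool" where
  "normal_at u v \<longleftrightarrow> norm v = 1 \<and> (\<forall>z\<in>K. P u * (z \<bullet> v) \<le> u \<bullet> v)"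

lemma radial_point:
  assumes "norm u = 1"
  shows "radial_fun K u *\<^sub>R u = u /\<^sub>R P u" "P (u /\<^sub>R P u) = 1"
    "u /\<^sub>R P u \<in> K" "(u /\<^sub>R P u) /\<^sub>R norm (u /\<^sub>R P u) = u"
proof -
  have u: "u \<noteq> 0" using assms by auto
  then have p: "P u > 0" by (rule max_slope_pos)
  show "radial_fun K u *\<^sub>R u = u /\<^sub>R P u" by (simp add: radial_fun_body[OF u] divide_inverse)
  show *: "P (u /\<^sub>R P u) = 1" using p by (simp add: max_slope_scaleR)
  then show "u /\<^sub>R P u \<in> K" by (simp add: body_eq)
  show "(u /\<^sub>R P u) /\<^sub>R norm (u /\<^sub>R P u) = u" using p assms by simp
qed

lemma normal_at_iff:
  assumes "norm u = 1"
  shows "normal_at u v \<longleftrightarrow> norm v = 1 \<and> (\<forall>z\<in>K. z \<bullet> v \<le> (u /\<^sub>R P u) \<bullet> v)"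
proof -
  have "u \<noteq> 0" using assms by auto
  then have "P u > 0" by (rule max_slope_pos)
  then show ?thesis by (auto simp: normal_at_def field_simps)
qed

lemma normal_at_iff_support_plane:
  assumes "norm u = 1"
  shows "normal_at u v \<longleftrightarrow> v \<in> sphere 0 1 \<and> radial_fun K u *\<^sub>R u \<in> support_plane K v"
  using assms support_plane_iff[OF radial_point(3)[OF assms]]
  by (simp add: normal_at_iff radial_point)

lemma reverse_radial_gauss_image_body:
  assumes "E \<subseteq> sphere 0 1"
  shows "reverse_radial_gauss_image K E = {u. norm u = 1 \<and> (\<exists>v\<in>E. normal_at u v)}"
proof (intro equalityI subsetI)
  fix y assume "y \<in> reverse_radial_gauss_image K E"
  then obtain x v where x: "v \<in> E" "x \<in> frontier K" "x \<in> support_plane K v" "y = x /\<^sub>R norm x"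
    by (auto simp: reverse_radial_gauss_image_def)
  have Px: "P x = 1" using x(2) by (simp add: frontier_body)
  then have x0: "norm x > 0" by auto
  have y: "norm y = 1" using x x0 by simp
  have "y /\<^sub>R P y = x" using x0 Px by (simp add: x max_slope_scaleR)
  moreover have "\<forall>z\<in>K. z \<bullet> v \<le> x \<bullet> v"
    using x(3) Px by (subst support_plane_iff[symmetric]) (auto simp: body_eq)
  ultimately have "normal_at y v"
    using x(1) assms by (simp add: normal_at_iff[OF y] subset_iff)
  then show "y \<in> {u. norm u = 1 \<and> (\<exists>v\<in>E. normal_at u v)}"
    using x(1) y by blast
next
  fix u assume "u \<in> {u. norm u = 1 \<and> (\<exists>v\<in>E. normal_at u v)}"
  then obtain v where u: "norm u = 1" "v \<in> E" "normal_at u v" by blast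
  let ?x = "u /\<^sub>R P u"
  have "?x \<in> frontier K \<inter> support_plane K v"
    using u radial_point[OF u(1)] by (simp add: frontier_body support_plane_iff normal_at_iff)
  then show "u \<in> reverse_radial_gauss_image K E"
    unfolding reverse_radial_gauss_image_def using u(2) radial_point(4)[OF u(1)]
    by (intro CollectI exI[of _ ?x] exI[of _ v]) auto
qed

text \<open>
  Every \<open>v\<close> in \<open>\<Omega>\<close> bounds the body by the half-space \<open>z \<bullet> v \<le> h v\<close>; the boundary point in
  direction \<open>u\<close> reaches this bound exactly when \<open>v\<close> is a maximiser.
\<close>
lemma maximizer_normal_at:
  assumes u: "norm u = 1" and v: "v \<in> \<Omega>" "P u = (u \<bullet> v) / h v"
  shows "normal_at u v" "support_fun K v = h v"
proof -
  have "u \<noteq> 0" using u by auto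
  then have p: "P u > 0" by (rule max_slope_pos)
  have "P u * h v = u \<bullet> v" using v(2) h_pos[OF v(1)] by simp
  then have eq: "(u /\<^sub>R P u) \<bullet> v = h v"
    using p by (simp add: divide_inverse[symmetric] mult.commute[of "inverse _"] divide_eq_eq mult.commute)
  have le: "z \<bullet> v \<le> h v" if "z \<in> K" for z using that v(1) by (auto simp: aleksandrov_body_def)
  then show "normal_at u v" using norm_\<Omega>[OF v(1)] eq by (simp add: normal_at_iff[OF u])
  then have "u /\<^sub>R P u \<in> support_plane K v"
    using normal_at_iff_support_plane[OF u] radial_point(1)[OF u] by simp
  then show "support_fun K v = h v" using eq by (simp add: support_plane_def)
qed

definition regular :: "'a set" where
  "regular = {u. norm u = 1 \<and> (\<exists>!v. normal_at u v)}"

lemma normal_at_radial_gauss: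
  assumes "u \<in> regular"
  shows "normal_at u v \<longleftrightarrow> v = radial_gauss K u"
proof -
  have u: "norm u = 1" and ex1: "\<exists>!v. normal_at u v" using assms by (auto simp: regular_def)
  have "radial_gauss K u = (THE v. normal_at u v)"
    unfolding radial_gauss_def by (simp add: normal_at_iff_support_plane[OF u])
  then show ?thesis using ex1 by (metis theI')
qed

text \<open>
  At a regular direction the normal is unique, and every maximiser is a normal; so the maximiser
  is unique too. This is where the geometry supplies the hypothesis of Danskin's theorem.
\<close>
lemma radial_gauss_maximizer:
  assumes "u \<in> regular"
  shows "radial_gauss K u \<in> \<Omega>" "P u = (u \<bullet> radial_gauss K u) / h (radial_gauss K u)"
    "support_fun K (radial_gauss K u) = h (radial_gauss K u)"
    "\<And>w. w \<in> \<Omega> \<Longrightarrow> P u = (u \<bullet> w) / h w \<Longrightarrow> w = radial_gauss K u"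
proof -
  have u: "norm u = 1" using assms by (auto simp: regular_def)
  show *: "w = radial_gauss K u" if "w \<in> \<Omega>" "P u = (u \<bullet> w) / h w" for w
    using maximizer_normal_at(1)[OF u that] normal_at_radial_gauss[OF assms] by simp
  obtain v where v: "v \<in> \<Omega>" "P u = (u \<bullet> v) / h v" using max_slope_attained by blast
  with *[OF v] maximizer_normal_at(2)[OF u v]
  show "radial_gauss K u \<in> \<Omega>" "P u = (u \<bullet> radial_gauss K u) / h (radial_gauss K u)"
    "support_fun K (radial_gauss K u) = h (radial_gauss K u)" by simp_all
qed

text \<open>
  The body contains the ball of radius \<open>hmin\<close>, which keeps its boundary points away from the
  origin, where the radial projection is not Lipschitz.
\<close>
lemma irregular_null: "sphere 0 1 - regular \<in> null_sets (sphere_measure :: 'a measure)"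
proof (rule null_sets_hausdorff_measure_subset[OF nonunique_normal_directions_null[OF convex_body closed_body hmin(1) cball_subset_body]])
  show "sphere 0 1 - regular \<subseteq> {x /\<^sub>R norm x | x. x \<in> K \<and> hmin \<le> norm x \<and> (\<exists>v w. norm v = 1 \<and> norm w = 1 \<and> v \<noteq> w \<and>
      (\<forall>z\<in>K. z \<bullet> v \<le> x \<bullet> v) \<and> (\<forall>z\<in>K. z \<bullet> w \<le> x \<bullet> w))}"
  proof
    fix u assume u': "u \<in> sphere 0 1 - regular"
    then have u: "norm u = 1" by simp
    obtain v where "v \<in> \<Omega>" "P u = (u \<bullet> v) / h v" using max_slope_attained by blast
    then have v: "normal_at u v" using maximizer_normal_at[OF u] by blast
    then obtain w where w: "normal_at u w" "v \<noteq> w" using u u' by (auto simp: regular_def)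
    let ?x = "u /\<^sub>R P u"
    have "1 \<le> norm ?x / hmin" using radial_point(2)[OF u] max_slope_le_norm[of ?x] by simp
    then have "hmin \<le> norm ?x" using hmin(1) by simp
    then show "u \<in> {x /\<^sub>R norm x | x. x \<in> K \<and> hmin \<le> norm x \<and> (\<exists>v w. norm v = 1 \<and> norm w = 1 \<and> v \<noteq> w \<and>
      (\<forall>z\<in>K. z \<bullet> v \<le> x \<bullet> v) \<and> (\<forall>z\<in>K. z \<bullet> w \<le> x \<bullet> w))}"
      using v w u radial_point(3,4)[OF u]
      by (intro CollectI exI[of _ ?x]) (auto simp: normal_at_iff simp del: norm_scaleR)
  qed
qed

text \<open>
  The graph of a function into a compact set is closed exactly when the function is continuous,
  and being a normal is a closed relation.
\<close>
lemma continuous_on_radial_gauss: "continuous_on regular (radial_gauss K)"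
proof -
  have maps: "radial_gauss K ` regular \<subseteq> sphere 0 1"
    using radial_gauss_maximizer(1) \<Omega>_sphere by blast
  have "closed {(u, v). normal_at u v}"
  proof -
    have "{(u, v). normal_at u v} = {p. norm (snd p) = 1} \<inter> (\<Inter>z\<in>K. {p. P (fst p) * (z \<bullet> snd p) \<le> fst p \<bullet> snd p})"
      by (auto simp: normal_at_def)
    moreover have "closed \<dots>"
      using continuous_on_compose2[OF continuous_on_max_slope continuous_on_fst[OF continuous_on_id]]
      by (intro closed_Int closed_INT closed_Collect_eq closed_Collect_le ballI continuous_intros) auto
    ultimately show ?thesis by simp
  qed
  moreover have "(\<lambda>u. (u, radial_gauss K u)) ` regular = (regular \<times> sphere 0 1) \<inter> {(u, v). normal_at u v}"
    using maps normal_at_radial_gauss by auto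
  ultimately have "closedin (top_of_set (regular \<times> sphere 0 1)) ((\<lambda>u. (u, radial_gauss K u)) ` regular)"
    by (simp add: closedin_closed_Int)
  then show ?thesis
    using continuous_closed_graph_eq[OF compact_sphere maps[unfolded image_subset_iff_funcset]] by simp
qed

end

section \<open>Variation of the gauge and of the dual volume\<close>

context positive_data
begin

lemma max_slope_perturbation_bound:
  assumes h': "positive_data \<Omega> h'" and u: "norm u = 1"
    and b: "\<And>v. v \<in> \<Omega> \<Longrightarrow> \<bar>1 / h' v - 1 / h v\<bar> \<le> b"
  shows "\<bar>max_slope \<Omega> h' u - P u\<bar> \<le> b"
proof -
  interpret h': positive_data \<Omega> h' by fact
  have le: "\<bar>(u \<bullet> v) / h' v - (u \<bullet> v) / h v\<bar> \<le> b" if v: "v \<in> \<Omega>" for v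
  proof -
    have "\<bar>u \<bullet> v\<bar> \<le> 1" using Cauchy_Schwarz_ineq2[of u v] u norm_\<Omega>[OF v] by simp
    then have "\<bar>u \<bullet> v\<bar> * \<bar>1 / h' v - 1 / h v\<bar> \<le> 1 * b" using b[OF v] by (intro mult_mono) auto
    then show ?thesis by (simp add: abs_mult[symmetric] right_diff_distrib)
  qed
  have "max_slope \<Omega> h' u \<le> P u + b"
    unfolding h'.max_slope_le_iff
  proof
    fix v assume "v \<in> \<Omega>"
    then show "(u \<bullet> v) / h' v \<le> P u + b" using le[of v] slope_le_max_slope[of v u] by linarith
  qed
  moreover have "P u \<le> max_slope \<Omega> h' u + b"
    unfolding max_slope_le_iff
  proof
    fix v assume "v \<in> \<Omega>"
    then show "(u \<bullet> v) / h v \<le> max_slope \<Omega> h' u + b" using le[of v] h'.slope_le_max_slope[of v u] by linarith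
  qed
  ultimately show ?thesis by (simp add: abs_le_iff)
qed

lemma max_slope_derivative:
  fixes H :: "real \<Rightarrow> 'a \<Rightarrow> real"
  assumes H: "\<forall>\<^sub>F \<epsilon> in at 0. continuous_on \<Omega> (H \<epsilon>) \<and> (\<forall>v\<in>\<Omega>. H \<epsilon> v > 0)"
    and H0: "\<And>v. v \<in> \<Omega> \<Longrightarrow> H 0 v = h v"
    and lim: "uniform_limit \<Omega> (\<lambda>\<epsilon> v. (1 / H \<epsilon> v - 1 / h v) / \<epsilon>) d (at 0)" and d: "continuous_on \<Omega> d"
    and u: "u \<in> regular"
  shows "((\<lambda>\<epsilon>. max_slope \<Omega> (H \<epsilon>) u) has_field_derivative (u \<bullet> radial_gauss K u) * d (radial_gauss K u)) (at 0)"
proof -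
  have u1: "norm u = 1" using u by (simp add: regular_def)
  have "((\<lambda>\<epsilon>. ((SUP v\<in>\<Omega>. (u \<bullet> v) / H \<epsilon> v) - (SUP v\<in>\<Omega>. (u \<bullet> v) / h v)) / \<epsilon>)
      \<longlongrightarrow> (u \<bullet> radial_gauss K u) * d (radial_gauss K u)) (at 0)"
  proof (rule danskin[OF compact_\<Omega>])
    show "continuous_on \<Omega> (\<lambda>v. (u \<bullet> v) / h v)" using h_pos by (intro continuous_intros cont_h) force
    show "\<forall>\<^sub>F \<epsilon> in at 0. continuous_on \<Omega> (\<lambda>v. (u \<bullet> v) / H \<epsilon> v)"
      using H
    proof eventually_elim
      case (elim \<epsilon>)
      then show ?case by (intro continuous_intros) auto
    qed
    show "continuous_on \<Omega> (\<lambda>v. (u \<bullet> v) * d v)" by (intro continuous_intros d)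
    show "uniform_limit \<Omega> (\<lambda>\<epsilon> v. ((u \<bullet> v) / H \<epsilon> v - (u \<bullet> v) / h v) / \<epsilon>) (\<lambda>v. (u \<bullet> v) * d v) (at 0)"
    proof (rule uniform_limitI)
      fix e :: real assume "e > 0"
      from uniform_limitD[OF lim this]
      show "\<forall>\<^sub>F \<epsilon> in at 0. \<forall>v\<in>\<Omega>. dist (((u \<bullet> v) / H \<epsilon> v - (u \<bullet> v) / h v) / \<epsilon>) ((u \<bullet> v) * d v) < e"
      proof eventually_elim
        case (elim \<epsilon>)
        show ?case
        proof
          fix v assume v: "v \<in> \<Omega>"
          let ?q = "(1 / H \<epsilon> v - 1 / h v) / \<epsilon> - d v"
          have "\<bar>u \<bullet> v\<bar> \<le> 1" using Cauchy_Schwarz_ineq2[of u v] u1 norm_\<Omega>[OF v] by simp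
          then have "\<bar>u \<bullet> v\<bar> * \<bar>?q\<bar> \<le> \<bar>?q\<bar>" by (rule mult_left_le_one_le[rotated 2]) auto
          also have "\<dots> < e" using elim v by (simp add: dist_real_def)
          also have "\<bar>u \<bullet> v\<bar> * \<bar>?q\<bar> = \<bar>((u \<bullet> v) / H \<epsilon> v - (u \<bullet> v) / h v) / \<epsilon> - (u \<bullet> v) * d v\<bar>"
            unfolding abs_mult[symmetric] by (simp add: right_diff_distrib)
          finally show "dist (((u \<bullet> v) / H \<epsilon> v - (u \<bullet> v) / h v) / \<epsilon>) ((u \<bullet> v) * d v) < e"
            by (simp add: dist_real_def)
        qed
      qed
    qed
    show "radial_gauss K u \<in> \<Omega>" by (rule radial_gauss_maximizer[OF u])
    show "(u \<bullet> v) / h v < (u \<bullet> radial_gauss K u) / h (radial_gauss K u)"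
      if "v \<in> \<Omega>" "v \<noteq> radial_gauss K u" for v
    proof -
      have "(u \<bullet> v) / h v \<noteq> P u" using radial_gauss_maximizer(4)[OF u that(1)] that(2) by metis
      then show ?thesis
        using slope_le_max_slope[OF that(1), of u] radial_gauss_maximizer(2)[OF u] by linarith
    qed
  qed
  moreover have "max_slope \<Omega> (H 0) = P" by (rule max_slope_cong) (rule H0)
  ultimately show ?thesis
    unfolding has_field_derivative_iff max_slope_def[symmetric] by simp
qed

lemma regular_subset_sphere: "regular \<subseteq> sphere 0 1"
  by (auto simp: regular_def)

lemma regular_in_sets: "regular \<in> sets (sphere_measure :: 'a measure)"
proof -
  have "regular = sphere 0 1 - (sphere 0 1 - regular)" using regular_subset_sphere by blast
  then show ?thesis using sphere_in_sets[where 'a='a] irregular_null by (metis null_setsD2 sets.Diff)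
qed

lemma radial_fun_bounds:
  obtains R where "compact R" "R \<subseteq> {0<..}" "\<And>u. norm u = 1 \<Longrightarrow> 1 / P u \<in> R"
proof -
  obtain m M where m: "0 < m" "\<And>u. u \<in> sphere 0 1 \<Longrightarrow> m \<le> P u \<and> P u \<le> M"
    using max_slope_sphere_bounds by blast
  have pos: "0 < 1 / max m M" using m(1) by simp
  show ?thesis
  proof (rule that[of "{1 / max m M..1 / m}"])
    show "1 / P u \<in> {1 / max m M..1 / m}" if "norm u = 1" for u
      using m(1) m(2)[of u] that by (auto intro!: divide_left_mono mult_pos_pos)
  qed (use m(1) in \<open>auto intro: less_le_trans[OF pos]\<close>)
qed

lemma continuous_on_radial:
  assumes G: "continuous_on ({0<..} \<times> sphere 0 1) (\<lambda>(t, u). G t u)" and S: "S \<subseteq> sphere 0 1"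
  shows "continuous_on S (\<lambda>u. 1 / P u)" "continuous_on S (\<lambda>u. G (1 / P u) u)"
proof -
  have p: "P u > 0" if "u \<in> S" for u using that S max_slope_pos_unit[of u] by (auto simp: subset_iff)
  show c: "continuous_on S (\<lambda>u. 1 / P u)"
    using p by (intro continuous_intros continuous_on_max_slope) force
  have "(\<lambda>u. (1 / P u, u)) ` S \<subseteq> {0<..} \<times> sphere 0 1" using p S by auto
  from continuous_on_compose2[OF G continuous_on_Pair[OF c continuous_on_id] this]
  show "continuous_on S (\<lambda>u. G (1 / P u) u)" by simp
qed

lemma dual_volume_body:
  assumes G: "continuous_on ({0<..} \<times> sphere 0 1) (\<lambda>(t, u). G t u)"
  shows "integrable sphere_measure (\<lambda>u. indicator (sphere 0 1) u * G (1 / P u) u)"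
    and "dual_volume G K = (\<integral>u. indicator (sphere 0 1) u * G (1 / P u) u \<partial>sphere_measure)"
proof -
  have c: "continuous_on (sphere 0 1) (\<lambda>u. G (1 / P u) u)" by (rule continuous_on_radial[OF G]) simp
  obtain B where B: "\<And>u. u \<in> sphere 0 1 \<Longrightarrow> \<bar>G (1 / P u) u\<bar> \<le> B"
    using bounded_on_compact[OF compact_sphere c] by blast
  show "integrable sphere_measure (\<lambda>u. indicator (sphere 0 1) u * G (1 / P u) u)"
  proof (rule integrable_on_sphere)
    show "(\<lambda>u. indicator (sphere 0 1) u * G (1 / P u) u) \<in> borel_measurable sphere_measure"
      using borel_measurable_hausdorff_continuous_indicator[OF sphere_in_sets c] by simp
    show "AE u in sphere_measure. \<bar>indicator (sphere 0 1) u * G (1 / P u) u\<bar> \<le> B * indicator (sphere 0 1) u"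
      using B by (auto simp: indicator_def)
  qed
  show "dual_volume G K = (\<integral>u. indicator (sphere 0 1) u * G (1 / P u) u \<partial>sphere_measure)"
    unfolding dual_volume_def set_lebesgue_integral_def
    by (intro Bochner_Integration.integral_cong) (auto simp: indicator_def radial_fun_body_unit)
qed

text \<open>
  Dominated convergence along an arbitrary sequence of parameters. The pointwise limit at regular
  directions is the chain rule applied to \<open>\<epsilon> \<mapsto> G (1 / P\<^sub>\<epsilon> u) u\<close>. For the bound, the radial
  functions of all bodies with small \<open>\<epsilon>\<close> take values in one compact interval of positive numbers,
  on which \<open>G\<close> is Lipschitz in its first argument, uniformly in \<open>u\<close>.
\<close>
lemma dual_volume_derivative:
  fixes H :: "real \<Rightarrow> 'a \<Rightarrow> real"
  assumes H: "\<forall>\<^sub>F \<epsilon> in at 0. continuous_on \<Omega> (H \<epsilon>) \<and> (\<forall>v\<in>\<Omega>. H \<epsilon> v > 0)"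
    and H0: "\<And>v. v \<in> \<Omega> \<Longrightarrow> H 0 v = h v"
    and lim: "uniform_limit \<Omega> (\<lambda>\<epsilon> v. (1 / H \<epsilon> v - 1 / h v) / \<epsilon>) d (at 0)" and d: "continuous_on \<Omega> d"
    and G: "continuous_on ({0<..} \<times> sphere 0 1) (\<lambda>(t, u). G t u)"
    and G_diff: "\<And>t u. t > 0 \<Longrightarrow> u \<in> sphere 0 1 \<Longrightarrow> (\<lambda>s. G s u) differentiable (at t)"
    and G_t: "continuous_on ({0<..} \<times> sphere 0 1) (\<lambda>(t, u). partial_t G t u)"
  shows "((\<lambda>\<epsilon>. (dual_volume G (aleksandrov_body \<Omega> (H \<epsilon>)) - dual_volume G K) / \<epsilon>) \<longlongrightarrow>
    (\<integral>u. indicator regular u * (partial_t G (1 / P u) u *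
      (- ((u \<bullet> radial_gauss K u) * d (radial_gauss K u)) / (P u)\<^sup>2)) \<partial>sphere_measure)) (at 0)"
proof -
  let ?S = "sphere_measure :: 'a measure" and ?\<alpha> = "radial_gauss K"
  define L where "L u = partial_t G (1 / P u) u * (- ((u \<bullet> ?\<alpha> u) * d (?\<alpha> u)) / (P u)\<^sup>2)" for u
  have der_G: "((\<lambda>s. G s u) has_field_derivative partial_t G t u) (at t)" if "t > 0" "u \<in> sphere 0 1" for t u
    using G_diff[OF that] unfolding partial_t_def by (metis DERIV_imp_deriv real_differentiableE)
  obtain m M where m: "0 < m" "\<And>u. u \<in> sphere 0 1 \<Longrightarrow> m \<le> P u \<and> P u \<le> M"
    using max_slope_sphere_bounds by blast
  obtain D where D: "D > 0" "\<And>v. v \<in> \<Omega> \<Longrightarrow> \<bar>d v\<bar> \<le> D" using bounded_on_compact[OF compact_\<Omega> d] by blast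
  define B where "B = D + 1"
  have B: "B > 0" using D by (simp add: B_def)
  have ev0: "\<forall>\<^sub>F \<epsilon> in at 0. dist \<epsilon> 0 < m / (2 * B) \<and> \<epsilon> \<noteq> 0"
    unfolding eventually_at using m(1) B by (intro exI[of _ "m / (2 * B)"]) auto
  have "\<forall>\<^sub>F \<epsilon> in at 0. positive_data \<Omega> (H \<epsilon>) \<and> (\<forall>v\<in>\<Omega>. \<bar>1 / H \<epsilon> v - 1 / h v\<bar> \<le> B * \<bar>\<epsilon>\<bar>) \<and> B * \<bar>\<epsilon>\<bar> \<le> m / 2"
    using H uniform_limitD[OF lim zero_less_one] ev0
  proof eventually_elim
    case (elim \<epsilon>)
    have "positive_data \<Omega> (H \<epsilon>)"
      using elim(1) closed_\<Omega> \<Omega>_sphere no_hemisphere by unfold_locales auto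
    moreover have "\<bar>1 / H \<epsilon> v - 1 / h v\<bar> \<le> B * \<bar>\<epsilon>\<bar>" if v: "v \<in> \<Omega>" for v
    proof -
      have "\<bar>(1 / H \<epsilon> v - 1 / h v) / \<epsilon>\<bar> \<le> B"
        using elim(2) v D(2)[OF v] by (auto simp: dist_real_def B_def dest!: bspec[of _ _ v])
      then show ?thesis using elim(3) unfolding abs_divide by (simp add: pos_divide_le_eq)
    qed
    moreover have "B * \<bar>\<epsilon>\<bar> \<le> m / 2" using elim(3) B by (simp add: field_simps)
    ultimately show ?case by blast
  qed
  then obtain \<delta> where \<delta>: "\<delta> > 0" and good: "\<And>\<epsilon>. \<epsilon> \<noteq> 0 \<Longrightarrow> \<bar>\<epsilon>\<bar> < \<delta> \<Longrightarrow> positive_data \<Omega> (H \<epsilon>) \<and>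
      (\<forall>v\<in>\<Omega>. \<bar>1 / H \<epsilon> v - 1 / h v\<bar> \<le> B * \<bar>\<epsilon>\<bar>) \<and> B * \<bar>\<epsilon>\<bar> \<le> m / 2"
    unfolding eventually_at by auto
  define R where "R = {1 / (M + m / 2)..2 / m}"
  have "\<exists>u :: 'a. norm u = 1" using nonempty_Basis norm_Basis by blast
  then have M: "M + m / 2 > 0" using m by (smt (verit) half_gt_zero mem_sphere_0)
  have R: "t > 0" if "t \<in> R" for t
    using that M by (auto simp: R_def intro: less_le_trans[OF divide_pos_pos[OF zero_less_one]])
  have "continuous_on (R \<times> sphere 0 1) (\<lambda>(t, u). partial_t G t u)"
    using R by (intro continuous_on_subset[OF G_t]) auto
  moreover have "compact (R \<times> (sphere 0 1 :: 'a set))" unfolding R_def by (intro compact_Times) auto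
  ultimately obtain C where C: "C > 0" "\<And>p. p \<in> R \<times> sphere 0 1 \<Longrightarrow> \<bar>case p of (t, u) \<Rightarrow> partial_t G t u\<bar> \<le> C"
    using bounded_on_compact by blast
  define q where "q \<epsilon> u = indicator (sphere 0 1) u * ((G (1 / max_slope \<Omega> (H \<epsilon>) u) u - G (1 / P u) u) / \<epsilon>)"
    for \<epsilon> and u :: 'a
  have vol: "(dual_volume G (aleksandrov_body \<Omega> (H \<epsilon>)) - dual_volume G K) / \<epsilon> = integral\<^sup>L ?S (q \<epsilon>)"
    "q \<epsilon> \<in> borel_measurable ?S"
    "\<And>u. \<bar>q \<epsilon> u\<bar> \<le> C * (2 * B / m\<^sup>2) * indicator (sphere 0 1) u"
    if \<epsilon>: "\<epsilon> \<noteq> 0" "\<bar>\<epsilon>\<bar> < \<delta>" for \<epsilon>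
  proof -
    interpret h': positive_data \<Omega> "H \<epsilon>" using good[OF \<epsilon>] by blast
    note int = h'.dual_volume_body(1)[OF G] dual_volume_body(1)[OF G]
    have q: "q \<epsilon> u = (indicator (sphere 0 1) u * G (1 / h'.P u) u - indicator (sphere 0 1) u * G (1 / P u) u) / \<epsilon>" for u
      by (simp add: q_def right_diff_distrib diff_divide_distrib)
    show "(dual_volume G h'.K - dual_volume G K) / \<epsilon> = integral\<^sup>L ?S (q \<epsilon>)"
      unfolding q h'.dual_volume_body(2)[OF G] dual_volume_body(2)[OF G] using int by simp
    have "integrable ?S (q \<epsilon>)" unfolding q using int by (intro integrable_divide Bochner_Integration.integrable_diff)
    then show "q \<epsilon> \<in> borel_measurable ?S" by (rule borel_measurable_integrable)
    fix u :: 'a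
    show "\<bar>q \<epsilon> u\<bar> \<le> C * (2 * B / m\<^sup>2) * indicator (sphere 0 1) u"
    proof (cases "u \<in> sphere 0 1")
      case True
      then have u: "norm u = 1" by simp
      have close: "\<bar>h'.P u - P u\<bar> \<le> B * \<bar>\<epsilon>\<bar>"
        using good[OF \<epsilon>] by (intro max_slope_perturbation_bound h'.positive_data_axioms u) auto
      have b: "m \<le> P u" "P u \<le> M" using m(2)[OF True] by auto
      have b': "m / 2 \<le> h'.P u" "h'.P u \<le> M + m / 2" using close b good[OF \<epsilon>] by linarith+
      have in_R: "1 / h'.P u \<in> R" "1 / P u \<in> R"
        using b b' m(1) divide_left_mono[of "m / 2" "h'.P u" 1] divide_left_mono[of "m / 2" "P u" 1]
          divide_left_mono[of "h'.P u" "M + m / 2" 1] divide_left_mono[of "P u" "M + m / 2" 1]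
        by (auto simp: R_def)
      have "norm (G (1 / h'.P u) u - G (1 / P u) u) \<le> C * norm (1 / h'.P u - 1 / P u)"
      proof (rule field_differentiable_bound[where S = R and f' = "\<lambda>t. partial_t G t u"])
        show "convex R" by (simp add: R_def)
        show "((\<lambda>t. G t u) has_field_derivative partial_t G t u) (at t within R)" if "t \<in> R" for t
          using der_G[OF R[OF that] True] by (rule has_field_derivative_at_within)
        show "norm (partial_t G t u) \<le> C" if "t \<in> R" for t using C(2)[of "(t, u)"] that True by simp
      qed (use in_R in auto)
      also have "norm (1 / h'.P u - 1 / P u) \<le> B * \<bar>\<epsilon>\<bar> / (m / 2 * m)"
      proof -
        have "1 / h'.P u - 1 / P u = (P u - h'.P u) / (h'.P u * P u)"
          using b b' m(1) by (simp add: field_simps)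
        then have "norm (1 / h'.P u - 1 / P u) = \<bar>h'.P u - P u\<bar> / (h'.P u * P u)"
          using b b' m(1) by (simp add: abs_mult abs_minus_commute)
        also have "\<dots> \<le> B * \<bar>\<epsilon>\<bar> / (m / 2 * m)"
          using b b' m(1) close B by (intro frac_le mult_mono) auto
        finally show ?thesis .
      qed
      finally have "\<bar>G (1 / h'.P u) u - G (1 / P u) u\<bar> \<le> C * (B * \<bar>\<epsilon>\<bar> / (m / 2 * m))"
        using C(1) by (simp add: mult_left_mono)
      then have "\<bar>G (1 / h'.P u) u - G (1 / P u) u\<bar> / \<bar>\<epsilon>\<bar> \<le> C * (2 * B / m\<^sup>2)"
        using \<epsilon> m(1) by (simp add: pos_divide_le_eq power2_eq_square field_simps)
      then show ?thesis using True by (simp add: q_def abs_divide)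
    qed (simp add: q_def)
  qed
  have meas_L: "(\<lambda>u. indicator regular u * L u) \<in> borel_measurable ?S"
  proof -
    have "P u \<noteq> 0" if "u \<in> regular" for u
      using that max_slope_pos_unit[of u] by (auto simp: regular_def)
    then have "continuous_on regular L"
      unfolding L_def using radial_gauss_maximizer(1)
      by (intro continuous_intros continuous_on_radial(2)[OF G_t regular_subset_sphere]
          continuous_on_compose2[OF d continuous_on_radial_gauss] continuous_on_radial_gauss continuous_on_max_slope) auto
    from borel_measurable_hausdorff_continuous_indicator[OF regular_in_sets this] show ?thesis by simp
  qed
  have "((\<lambda>\<epsilon>. (dual_volume G (aleksandrov_body \<Omega> (H \<epsilon>)) - dual_volume G K) / \<epsilon>) \<longlongrightarrow>
    (\<integral>u. indicator regular u * L u \<partial>?S)) (at 0 within {-\<delta><..<\<delta>})"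
    unfolding tendsto_at_iff_sequentially o_def
  proof (intro allI impI)
    fix X :: "nat \<Rightarrow> real" assume X: "\<forall>i. X i \<in> {-\<delta><..<\<delta>} - {0}" and X0: "X \<longlonglongrightarrow> 0"
    have X': "X i \<noteq> 0" "\<bar>X i\<bar> < \<delta>" for i using X by (auto simp: abs_less_iff dest: spec[of _ i])
    have "(\<lambda>i. integral\<^sup>L ?S (q (X i))) \<longlonglongrightarrow> (\<integral>u. indicator regular u * L u \<partial>?S)"
    proof (rule integral_dominated_convergence)
      show "integrable ?S (\<lambda>u. C * (2 * B / m\<^sup>2) * indicator (sphere 0 1) u)"
        using C(1) B sphere_in_sets[where 'a='a]
        by (intro integrable_on_sphere[where B = "C * (2 * B / m\<^sup>2)"]) auto
      show "AE u in ?S. (\<lambda>i. q (X i) u) \<longlonglongrightarrow> indicator regular u * L u"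
        using AE_not_in[OF irregular_null]
      proof eventually_elim
        case (elim u)
        show ?case
        proof (cases "u \<in> regular")
          case True
          then have us: "u \<in> sphere 0 1" using regular_subset_sphere by blast
          then have "u \<noteq> 0" by auto
          then have p: "P u > 0" by (rule max_slope_pos)
          have P0: "max_slope \<Omega> (H 0) = P" by (rule max_slope_cong) (rule H0)
          note dP = max_slope_derivative[OF H H0 lim d True]
          have "((\<lambda>\<epsilon>. 1 / max_slope \<Omega> (H \<epsilon>) u) has_field_derivative
              - ((u \<bullet> ?\<alpha> u) * d (?\<alpha> u)) / (P u)\<^sup>2) (at 0)"
            using p by (auto intro!: derivative_eq_intros dP simp: P0 power2_eq_square)
          then have "((\<lambda>\<epsilon>. G (1 / max_slope \<Omega> (H \<epsilon>) u) u) has_field_derivative L u) (at 0)"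
            unfolding L_def using der_G[of "1 / P u" u] p us by (intro DERIV_chain2[where f = "\<lambda>s. G s u"]) (auto simp: P0)
          then have "((\<lambda>\<epsilon>. (G (1 / max_slope \<Omega> (H \<epsilon>) u) u - G (1 / P u) u) / \<epsilon>) \<longlongrightarrow> L u) (at 0)"
            by (simp add: has_field_derivative_iff P0)
          then have "(\<lambda>i. (G (1 / max_slope \<Omega> (H (X i)) u) u - G (1 / P u) u) / X i) \<longlonglongrightarrow> L u"
            using X'(1) X0 unfolding tendsto_at_iff_sequentially o_def by auto
          then show ?thesis using True us by (simp add: q_def)
        next
          case False
          then have "u \<notin> sphere 0 1" using elim by blast
          then show ?thesis using False by (simp add: q_def)
        qed
      qed
      show "AE u in ?S. norm (q (X i) u) \<le> C * (2 * B / m\<^sup>2) * indicator (sphere 0 1) u" for i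
        using vol(3)[OF X'] by simp
    qed (use meas_L vol(2)[OF X'] in auto)
    then show "(\<lambda>i. (dual_volume G (aleksandrov_body \<Omega> (H (X i))) - dual_volume G K) / X i)
        \<longlonglongrightarrow> (\<integral>u. indicator regular u * L u \<partial>?S)"
      using vol(1)[OF X'] by simp
  qed
  then show ?thesis
    using \<delta> unfolding L_def by (subst (asm) at_within_open) auto
qed

text \<open>
  Up to null sets the reverse radial Gauss image of \<open>E\<close> is the preimage of \<open>E\<close> under the radial
  Gauss map. So the dual curvature measure is the image of a signed measure with bounded density
  on the sphere, and the change-of-variables formula applies.
\<close>
lemma signed_integral_dual_curvature:
  assumes G_t: "continuous_on ({0<..} \<times> sphere 0 1) (\<lambda>(t, u). partial_t G t u)"
    and \<psi>: "continuous_on {0<..} \<psi>" "\<And>t. t > 0 \<Longrightarrow> \<psi> t \<noteq> 0" and g: "continuous_on \<Omega> g"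
  shows "real DIM('a) * signed_set_integral (restrict_space borel (sphere 0 1)) (dual_curvature G \<psi> K) \<Omega> g
    = (\<integral>u. indicator regular u * (1 / P u * partial_t G (1 / P u) u / \<psi> (h (radial_gauss K u)) * g (radial_gauss K u)) \<partial>sphere_measure)"
proof -
  let ?S = "sphere_measure :: 'a measure" and ?\<alpha> = "radial_gauss K"
  let ?M = "restrict_space borel (sphere 0 1) :: 'a measure"
  define n where "n = real DIM('a)"
  have n: "n > 0" by (simp add: n_def)
  define F where "F u = 1 / P u * partial_t G (1 / P u) u / \<psi> (h (?\<alpha> u))" for u
  define f where "f u = indicator regular u * (1 / n * F u)" for u
  \<comment> \<open>The Gauss map is made total by an arbitrary unit vector, since the image measure lives on the
    sphere; the density vanishes outside the regular directions.\<close>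
  define b :: 'a where "b = (SOME b. b \<in> Basis)"
  have b: "norm b = 1" unfolding b_def using nonempty_Basis norm_Basis by (metis some_in_eq)
  define T where "T u = (if u \<in> regular then ?\<alpha> u else b)" for u
  have \<alpha>: "?\<alpha> u \<in> \<Omega>" "norm (?\<alpha> u) = 1" if "u \<in> regular" for u
    using radial_gauss_maximizer(1)[OF that] norm_\<Omega> by auto
  have T: "T \<in> measurable ?S ?M"
  proof (rule measurable_restrict_space2)
    have "(\<lambda>u. indicator regular u *\<^sub>R ?\<alpha> u) \<in> borel_measurable ?S"
      by (rule borel_measurable_hausdorff_continuous_indicator[OF regular_in_sets continuous_on_radial_gauss])
    moreover have "(\<lambda>u. indicator (UNIV - regular) u *\<^sub>R b) \<in> borel_measurable ?S"
      using sets.compl_sets[OF regular_in_sets]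
      by (intro borel_measurable_hausdorff_continuous_indicator) auto
    ultimately have "(\<lambda>u. indicator regular u *\<^sub>R ?\<alpha> u + indicator (UNIV - regular) u *\<^sub>R b) \<in> borel_measurable ?S"
      by (rule borel_measurable_add)
    also have "(\<lambda>u. indicator regular u *\<^sub>R ?\<alpha> u + indicator (UNIV - regular) u *\<^sub>R b) = T"
      by (auto simp: T_def indicator_def)
    finally show "T \<in> borel_measurable ?S" .
    show "T \<in> space ?S \<rightarrow> sphere 0 1" using b \<alpha> by (auto simp: T_def)
  qed
  have cF: "continuous_on regular F"
  proof -
    have "continuous_on regular (\<lambda>u. h (?\<alpha> u))"
      using \<alpha> by (intro continuous_on_compose2[OF cont_h continuous_on_radial_gauss]) auto
    then have "continuous_on regular (\<lambda>u. \<psi> (h (?\<alpha> u)))"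
      using \<alpha> h_pos by (intro continuous_on_compose2[OF \<psi>(1)]) auto
    then show ?thesis
      unfolding F_def using \<alpha> h_pos \<psi>(2)
      by (intro continuous_on_divide continuous_on_mult continuous_on_radial[OF G_t regular_subset_sphere]) auto
  qed
  have f_meas: "f \<in> borel_measurable ?S"
  proof -
    have "continuous_on regular (\<lambda>u. 1 / n * F u)" using cF by (intro continuous_intros)
    from borel_measurable_hausdorff_continuous_indicator[OF regular_in_sets this]
    show ?thesis by (simp add: f_def[abs_def])
  qed
  have f_int: "integrable ?S f"
  proof -
    obtain R where R: "compact R" "R \<subseteq> {0<..}" "\<And>u. norm u = 1 \<Longrightarrow> 1 / P u \<in> R"
      using radial_fun_bounds by blast
    have "continuous_on (R \<times> sphere 0 1) (\<lambda>p. fst p * (case p of (t, u) \<Rightarrow> partial_t G t u))"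
      using R(2) by (intro continuous_on_mult continuous_on_fst continuous_on_id continuous_on_subset[OF G_t]) auto
    moreover have "compact (R \<times> (sphere 0 1 :: 'a set))" using R(1) by (intro compact_Times) auto
    ultimately obtain B1 where B1: "\<And>p. p \<in> R \<times> sphere 0 1 \<Longrightarrow> \<bar>fst p * (case p of (t, u) \<Rightarrow> partial_t G t u)\<bar> \<le> B1"
      using bounded_on_compact by blast
    have "continuous_on \<Omega> (\<lambda>v. 1 / \<psi> (h v))"
      using h_pos \<psi>(2) by (intro continuous_on_divide continuous_on_const continuous_on_compose2[OF \<psi>(1) cont_h]) auto
    then obtain B2 where B2: "\<And>v. v \<in> \<Omega> \<Longrightarrow> \<bar>1 / \<psi> (h v)\<bar> \<le> B2"
      using bounded_on_compact[OF compact_\<Omega>] by blast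
    have "\<bar>f u\<bar> \<le> (1 / n * (B1 * B2)) * indicator (sphere 0 1) u" for u
    proof (cases "u \<in> regular")
      case True
      then have u: "norm u = 1" "u \<in> sphere 0 1" using regular_subset_sphere by auto
      have "\<bar>1 / P u * partial_t G (1 / P u) u\<bar> * \<bar>1 / \<psi> (h (?\<alpha> u))\<bar> \<le> B1 * B2"
        using B1[of "(1 / P u, u)"] B2[OF \<alpha>(1)[OF True]] R(3)[OF u(1)] u by (intro mult_mono') auto
      then have "\<bar>F u\<bar> \<le> B1 * B2" by (simp add: F_def abs_mult)
      then show ?thesis using True u n by (simp add: f_def abs_mult divide_right_mono)
    next
      case False
      have "0 \<le> B1 * B2"
      proof -
        obtain v where "v \<in> \<Omega>" using \<Omega>_nonempty by blast
        then show ?thesis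
          using R(3)[OF b] b
          by (intro mult_nonneg_nonneg order_trans[OF abs_ge_zero B1[of "(1 / P b, b)"]]
              order_trans[OF abs_ge_zero B2[of v]]) auto
      qed
      then show ?thesis using False n by (simp add: f_def)
    qed
    then show ?thesis by (intro integrable_on_sphere[OF f_meas] AE_I2)
  qed
  have \<Omega>_M: "\<Omega> \<in> sets ?M" using closed_\<Omega> \<Omega>_sphere by (auto simp: sets_restrict_space image_iff intro!: bexI[of _ \<Omega>])
  have g_meas: "(\<lambda>v. indicator \<Omega> v *\<^sub>R g v) \<in> borel_measurable ?M"
    using borel_measurable_continuous_on_indicator[OF borel_closed[OF closed_\<Omega>] g]
    by (rule measurable_restrict_space1)
  obtain Bg where Bg: "\<And>v. v \<in> \<Omega> \<Longrightarrow> \<bar>g v\<bar> \<le> Bg" using bounded_on_compact[OF compact_\<Omega> g] by blast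
  have "signed_set_integral ?M (dual_curvature G \<psi> K) \<Omega> g = (\<integral>u. f u * (indicator \<Omega> (T u) * g (T u)) \<partial>?S)"
  proof (rule signed_set_integral_image[OF T f_int _ g_meas Bg])
    fix E assume "E \<in> sets ?M"
    then have E_M: "E \<in> sets ?M" .
    then have E: "E \<subseteq> sphere 0 1" using sets.sets_into_space[OF E_M] by (simp add: space_restrict_space)
    let ?I = "reverse_radial_gauss_image K E"
    define k where "k u = indicator ?I u * (radial_fun K u * partial_t G (radial_fun K u) u / \<psi> (support_fun K (?\<alpha> u)))" for u
    have k: "k u = n * (f u * indicator E (T u))" if u: "u \<notin> sphere 0 1 - regular" for u
    proof (cases "u \<in> regular")
      case True
      then have u1: "norm u = 1" by (simp add: regular_def)
      then have "u \<noteq> 0" by auto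
      moreover have "u \<in> ?I \<longleftrightarrow> ?\<alpha> u \<in> E"
        using u1 normal_at_radial_gauss[OF True] by (auto simp: reverse_radial_gauss_image_body[OF E])
      ultimately show ?thesis
        using True n radial_gauss_maximizer(3)[OF True]
        by (auto simp: k_def f_def F_def T_def radial_fun_body indicator_def)
    next
      case False
      then have "u \<notin> ?I" using u by (auto simp: reverse_radial_gauss_image_body[OF E])
      then show ?thesis using False by (simp add: k_def f_def)
    qed
    have meas: "(\<lambda>u. n * (f u * indicator E (T u))) \<in> borel_measurable ?S"
      using f_meas T E_M by measurable
    have "dual_curvature G \<psi> K E = 1 / n * integral\<^sup>L ?S k"
      unfolding dual_curvature_def set_lebesgue_integral_def k_def[abs_def] n_def by simp
    also have "integral\<^sup>L ?S k = (\<integral>u. n * (f u * indicator E (T u)) \<partial>?S)"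
    proof (rule integral_cong_AE[OF _ meas])
      show "k \<in> borel_measurable ?S"
        using k by (rule borel_measurable_hausdorff_modify_null[OF meas irregular_null])
      show "AE u in ?S. k u = n * (f u * indicator E (T u))"
        using AE_not_in[OF irregular_null] by eventually_elim (rule k)
    qed
    finally show "dual_curvature G \<psi> K E = (\<integral>u. f u * indicator E (T u) \<partial>?S)" using n by simp
  qed
  then have "n * signed_set_integral ?M (dual_curvature G \<psi> K) \<Omega> g = (\<integral>u. n * (f u * (indicator \<Omega> (T u) * g (T u))) \<partial>?S)"
    by simp
  also have "\<dots> = (\<integral>u. indicator regular u * (F u * g (?\<alpha> u)) \<partial>?S)"
    using n \<alpha> by (intro Bochner_Integration.integral_cong refl) (auto simp: f_def T_def indicator_def)
  finally show ?thesis by (simp add: F_def n_def)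
qed

end

section \<open>The variational formula\<close>

theorem theorem5p3:
  fixes \<Omega> :: "'a::euclidean_space set"
    and g h0 :: "'a \<Rightarrow> real"
    and a :: ereal
    and \<phi> :: "real \<Rightarrow> real"
    and G :: "real \<Rightarrow> 'a \<Rightarrow> real"
  assumes "closed \<Omega>" and "\<Omega> \<subseteq> sphere 0 1"
    and "\<not> (\<exists>v \<in> sphere 0 1. \<Omega> \<subseteq> closed_hemisphere v)"
    and "continuous_on \<Omega> g"
    and "continuous_on \<Omega> h0" and "\<forall>u\<in>\<Omega>. h0 u > 0"
    and "a \<noteq> \<infinity>"
    and "\<phi> \<in> class_J a"
    and "\<phi> C1_differentiable_on {0<..}"
    and "\<forall>t>0. deriv \<phi> t \<noteq> 0"
    and "\<forall>t>0. \<forall>u\<in>sphere 0 1. G t u > 0"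
    and "continuous_on ({0<..} \<times> sphere 0 1) (\<lambda>(t, u). G t u)"
    and "\<forall>t>0. \<forall>u\<in>sphere 0 1. (\<lambda>s. G s u) differentiable (at t)"
    and "continuous_on ({0<..} \<times> sphere 0 1) (\<lambda>(t, u). partial_t G t u)"
  shows "((\<lambda>\<epsilon>. (dual_volume G (aleksandrov_body \<Omega> (orlicz_perturbation \<phi> h0 g \<epsilon>))
                 - dual_volume G (aleksandrov_body \<Omega> h0)) / \<epsilon>)
          \<longlongrightarrow>
          real DIM('a) *
          signed_set_integral (restrict_space borel (sphere 0 1))
            (dual_curvature G (\<lambda>t. t * deriv \<phi> t) (aleksandrov_body \<Omega> h0)) \<Omega> g)
         (at 0)"
proof -
  interpret positive_data \<Omega> h0
    using assms(1-6) by unfold_locales auto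
  have inj: "inj_on \<phi> {0<..}"
  proof (rule inj_onI, rule ccontr)
    fix s t :: real assume st: "s \<in> {0<..}" "t \<in> {0<..}" "\<phi> s = \<phi> t" "s \<noteq> t"
    have "strict_mono_on {0<..} \<phi> \<or> strict_antimono_on {0<..} \<phi>"
      using assms(8) by (simp add: class_J_def)
    then show False
      using st monotone_onD[of "{0<..}" "(<)" "(<)" \<phi> s t] monotone_onD[of "{0<..}" "(<)" "(<)" \<phi> t s]
        monotone_onD[of "{0<..}" "(<)" "(>)" \<phi> s t] monotone_onD[of "{0<..}" "(<)" "(>)" \<phi> t s]
      by (cases s t rule: linorder_cases) auto
  qed
  have \<phi>': "\<And>t. t > 0 \<Longrightarrow> deriv \<phi> t \<noteq> 0" using assms(10) by blast
  have pert: "\<forall>\<^sub>F \<epsilon> in at 0. continuous_on \<Omega> (orlicz_perturbation \<phi> h0 g \<epsilon>) \<and>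
      (\<forall>v\<in>\<Omega>. orlicz_perturbation \<phi> h0 g \<epsilon> v > 0)"
    "uniform_limit \<Omega> (\<lambda>\<epsilon> v. (1 / orlicz_perturbation \<phi> h0 g \<epsilon> v - 1 / h0 v) / \<epsilon>)
      (\<lambda>v. - g v / ((h0 v)\<^sup>2 * deriv \<phi> (h0 v))) (at 0)"
    and \<phi>'_cont: "continuous_on {0<..} (deriv \<phi>)"
    by (rule orlicz_perturbation_reciprocal; fact compact_\<Omega> assms(4) cont_h h_pos inj assms(9) \<phi>')+
  have pert0: "orlicz_perturbation \<phi> h0 g 0 v = h0 v" if "v \<in> \<Omega>" for v
    by (rule orlicz_perturbation_reciprocal; fact compact_\<Omega> assms(4) cont_h h_pos inj assms(9) \<phi>' that)
  let ?d = "\<lambda>v. - g v / ((h0 v)\<^sup>2 * deriv \<phi> (h0 v))" and ?\<psi> = "\<lambda>t. t * deriv \<phi> t"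
  have d: "continuous_on \<Omega> ?d"
    using h_pos \<phi>' by (intro continuous_intros assms(4) cont_h continuous_on_compose2[OF \<phi>'_cont cont_h]) force+
  have G_diff: "\<And>t u. t > 0 \<Longrightarrow> u \<in> sphere 0 1 \<Longrightarrow> (\<lambda>s. G s u) differentiable (at t)" using assms(13) by blast
  have \<psi>: "continuous_on {0<..} ?\<psi>" "\<And>t. t > 0 \<Longrightarrow> ?\<psi> t \<noteq> 0"
    using \<phi>'_cont \<phi>' by (auto intro!: continuous_intros)
  have eq: "indicator regular u * (partial_t G (1 / P u) u *
      (- ((u \<bullet> radial_gauss K u) * ?d (radial_gauss K u)) / (P u)\<^sup>2))
    = indicator regular u * (1 / P u * partial_t G (1 / P u) u / ?\<psi> (h0 (radial_gauss K u)) * g (radial_gauss K u))" for u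
  proof (cases "u \<in> regular")
    case True
    let ?v = "radial_gauss K u"
    have "u \<noteq> 0" using True by (auto simp: regular_def)
    then have p: "P u > 0" by (rule max_slope_pos)
    have hv: "h0 ?v > 0" "deriv \<phi> (h0 ?v) \<noteq> 0" using radial_gauss_maximizer(1)[OF True] h_pos \<phi>' by auto
    have "P u = (u \<bullet> ?v) / h0 ?v" by (rule radial_gauss_maximizer(2)[OF True])
    then have "u \<bullet> ?v = P u * h0 ?v" using hv by simp
    then show ?thesis using True p hv by (simp add: power2_eq_square)
  qed simp
  have "real DIM('a) * signed_set_integral (restrict_space borel (sphere 0 1)) (dual_curvature G ?\<psi> K) \<Omega> g
    = (\<integral>u. indicator regular u * (1 / P u * partial_t G (1 / P u) u / ?\<psi> (h0 (radial_gauss K u)) * g (radial_gauss K u)) \<partial>sphere_measure)"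
    by (rule signed_integral_dual_curvature; fact assms(14) \<psi> assms(4))
  moreover have "((\<lambda>\<epsilon>. (dual_volume G (aleksandrov_body \<Omega> (orlicz_perturbation \<phi> h0 g \<epsilon>)) - dual_volume G K) / \<epsilon>)
    \<longlongrightarrow> (\<integral>u. indicator regular u * (partial_t G (1 / P u) u *
      (- ((u \<bullet> radial_gauss K u) * ?d (radial_gauss K u)) / (P u)\<^sup>2)) \<partial>sphere_measure)) (at 0)"
    by (rule dual_volume_derivative; fact pert pert0 d assms(12) G_diff assms(14))
  ultimately show ?thesis by (simp only: eq)
qed

end
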